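(* Let $F\in\mathcal{L}^d$, and assume that $F$ has a representation $$F(z)=c+\langle zv,v\rangle+\langle (z-z_0^* )(X-z)^{-1}(z-z_0)v,v\rangle\qquad(z\in\Pi^d),$$ where $c\in\mathbb{R}$, $z_0\in\Pi^d$, $X$ is a densely defined self-adjoint operator on a Hilbert space $\mathcal{M}=\mathcal{M}^1\oplus\dots\oplus\mathcal{M}^d$, and $v\in\mathcal{M}$. For $z\in\Pi^d$ let $v_z=v+(X-z)^{-1}(z-z_0)v$. Then the following are equivalent. (i) There exists a constant $C\in\mathbb{R}$ such that $\liminf_{y\to\infty}\,y\,|F(iy\mathbb{1})-C|<\infty$. (ii) There exist a vector $v_1\in\mathcal{M}$ and a constant $C\in\mathbb{R}$ such that $F(z)=C+\langle(X-z)^{-1}v_1,v_1\rangle$ for all $z\in\Pi^d$. (iii) The function $\varphi=\beta\circ F\circ\alpha$ in $\mathcal{S}^d$ has a $B$-point at $\mathbb{1}$ and $\varphi(\mathbb{1})\ne1$. (iv) $\lim_{y\to\infty}F(iy\mathbb{1})=C\in\mathbb{R}$ and $\liminf_{y\to\infty}\,y\,\|v_{iy\mathbb{1}}\|<\infty$. (v) The vector $v$ is in the domain of $X$.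
   Context: $\Pi=\{z\in\mathbb{C}:\operatorname{Im}z>0\}$, $\mathbb{D}$ is the open unit disc, $\mathbb{1}=(1,\dots,1)$ and $s\mathbb{1}=(s,\dots,s)$. The Schur class $\mathcal{S}^d$ is the set of analytic functions $\mathbb{D}^d\to\overline{\mathbb{D}}$. The Löwner class $\mathcal{L}^d$ is the set of functions $F:\Pi^d\to\overline{\Pi}$ for which there exist $d$ positive semi-definite kernels $A^1,\dots,A^d$ on $\Pi^d$ such that $F(z)-\overline{F(w)}=\sum_{r=1}^d(z^r-\overline{w^r})A^r(z,w)$ for all $z,w\in\Pi^d$ (such functions are automatically analytic). On $\mathcal{M}=\mathcal{M}^1\oplus\dots\oplus\mathcal{M}^d$, a point $z=(z^1,\dots,z^d)\in\mathbb{C}^d$ is identified with the operator $z^1I_{\mathcal{M}^1}\oplus\dots\oplus z^dI_{\mathcal{M}^d}$, and $z^*$ with its adjoint. For $z\in\Pi^d$ and $X$ self-adjoint, $X-z$ has a bounded inverse. $\alpha(\lambda)=i\frac{1+\lambda}{1-\lambda}$ maps $\mathbb{D}$ to $\Pi$, with inverse $\beta(z)=\frac{z-i}{z+i}$; on $d$-tuples, $\alpha$ is applied coordinate-wise. A point $\tau\in\mathbb{T}^d$ is a $B$-point of $\varphi\in\mathcal{S}^d$ if there is a sequence $\lambda_n\in\mathbb{D}^d$ converging to $\tau$ such that $\dfrac{1-|\varphi(\lambda_n)|}{1-\max_r|\lambda_n^r|}$ is bounded. At a $B$-point $\tau$, $\varphi$ has a non-tangential limit, denoted $\varphi(\tau)$.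 *)

theory Defs
  imports "HOL-Analysis.Analysis"
begin

text \<open>The underlying real Hilbert space structure, with inner product the real part of the
  complex one, supplies norm and topology. The complex inner product is linear in its first
  argument.\<close>

class complex_hilbert = real_inner + complete_space +
  fixes scaleC :: "complex \<Rightarrow> 'a \<Rightarrow> 'a" (infixr \<open>*\<^sub>C\<close> 75)
    and cinner :: "'a \<Rightarrow> 'a \<Rightarrow> complex"
  assumes scaleC_add_right: "a *\<^sub>C (x + y) = a *\<^sub>C x + a *\<^sub>C y"
    and scaleC_add_left: "(a + b) *\<^sub>C x = a *\<^sub>C x + b *\<^sub>C x"
    and scaleC_scaleC: "a *\<^sub>C (b *\<^sub>C x) = (a * b) *\<^sub>C x"
    and scaleC_of_real: "of_real r *\<^sub>C x = r *\<^sub>R x"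
    and cinner_commute: "cinner x y = cnj (cinner y x)"
    and cinner_add_left: "cinner (x + y) z = cinner x z + cinner y z"
    and cinner_scaleC_left: "cinner (a *\<^sub>C x) y = a * cinner x y"
    and Re_cinner: "Re (cinner x y) = inner x y"

interpretation complex_vector: vector_space "scaleC :: complex \<Rightarrow> 'h \<Rightarrow> 'h::complex_hilbert"
proof
  show "1 *\<^sub>C x = x" for x :: 'h
    using scaleC_of_real[of 1 x] by simp
qed (simp_all add: scaleC_add_right scaleC_add_left scaleC_scaleC)

definition orthogonal_decomposition :: "('d::finite \<Rightarrow> 'h::complex_hilbert set) \<Rightarrow> bool" where
  "orthogonal_decomposition M \<longleftrightarrow>
     (\<forall>r. complex_vector.subspace (M r) \<and> closed (M r)) \<and>
     (\<forall>r s. r \<noteq> s \<longrightarrow> (\<forall>x\<in>M r. \<forall>y\<in>M s. cinner x y = 0)) \<and>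
     (\<forall>x. \<exists>u. (\<forall>r. u r \<in> M r) \<and> x = (\<Sum>r\<in>UNIV. u r))"

definition components :: "('d::finite \<Rightarrow> 'h::complex_hilbert set) \<Rightarrow> 'h \<Rightarrow> 'd \<Rightarrow> 'h" where
  "components M x = (THE u. (\<forall>r. u r \<in> M r) \<and> x = (\<Sum>r\<in>UNIV. u r))"

text \<open>The point \<open>z\<close> regarded as the operator \<open>z\<^sup>1 I \<oplus> \<dots> \<oplus> z\<^sup>d I\<close>; its adjoint is the operator of
  the conjugate point.\<close>

definition point_op ::
  "('d::finite \<Rightarrow> 'h::complex_hilbert set) \<Rightarrow> complex ^ 'd \<Rightarrow> 'h \<Rightarrow> 'h" where
  "point_op M z x = (\<Sum>r\<in>UNIV. (z $ r) *\<^sub>C components M x r)"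

definition cnj_vec :: "complex ^ 'd \<Rightarrow> complex ^ 'd" where
  "cnj_vec z = (\<chi> r. cnj (z $ r))"

text \<open>An operator is a function \<open>X\<close> together with its domain \<open>D\<close>; values of \<open>X\<close> outside \<open>D\<close> are
  irrelevant.\<close>

definition densely_defined_operator :: "'h::complex_hilbert set \<Rightarrow> ('h \<Rightarrow> 'h) \<Rightarrow> bool" where
  "densely_defined_operator D X \<longleftrightarrow>
     complex_vector.subspace D \<and> closure D = UNIV \<and>
     (\<forall>x\<in>D. \<forall>y\<in>D. X (x + y) = X x + X y) \<and>
     (\<forall>a. \<forall>x\<in>D. X (a *\<^sub>C x) = a *\<^sub>C X x)"

definition adjoint_graph :: "'h::complex_hilbert set \<Rightarrow> ('h \<Rightarrow> 'h) \<Rightarrow> ('h \<times> 'h) set" where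
  "adjoint_graph D X = {(y, w). \<forall>x\<in>D. cinner (X x) y = cinner x w}"

definition self_adjoint :: "'h::complex_hilbert set \<Rightarrow> ('h \<Rightarrow> 'h) \<Rightarrow> bool" where
  "self_adjoint D X \<longleftrightarrow>
     densely_defined_operator D X \<and> adjoint_graph D X = (\<lambda>x. (x, X x)) ` D"

text \<open>\<open>X - z\<close> maps \<open>D\<close> bijectively onto the whole space when \<open>X\<close> is self-adjoint and \<open>z\<close> lies in the
  poly-half-plane; \<open>resolvent\<close> is only meant for that case.\<close>

definition resolvent ::
  "('d::finite \<Rightarrow> 'h::complex_hilbert set) \<Rightarrow> 'h set \<Rightarrow> ('h \<Rightarrow> 'h) \<Rightarrow> complex ^ 'd \<Rightarrow> 'h \<Rightarrow> 'h"
  where "resolvent M D X z = inv_into D (\<lambda>x. X x - point_op M z x)"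

definition poly_halfplane :: "(complex ^ 'd) set" where
  "poly_halfplane = {z. \<forall>r. Im (z $ r) > 0}"

definition polydisc :: "(complex ^ 'd) set" where
  "polydisc = {l. \<forall>r. cmod (l $ r) < 1}"

definition torus :: "(complex ^ 'd) set" where
  "torus = {t. \<forall>r. cmod (t $ r) = 1}"

definition psd_kernel :: "'a set \<Rightarrow> ('a \<Rightarrow> 'a \<Rightarrow> complex) \<Rightarrow> bool" where
  "psd_kernel S A \<longleftrightarrow>
     (\<forall>T c. finite T \<and> T \<subseteq> S \<longrightarrow>
        (\<Sum>z\<in>T. \<Sum>w\<in>T. c z * cnj (c w) * A z w) \<in> \<real>\<^sub>\<ge>\<^sub>0)"

definition loewner_class :: "(complex ^ 'd \<Rightarrow> complex) set" where
  "loewner_class = {F.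
     (\<forall>z\<in>poly_halfplane. Im (F z) \<ge> 0) \<and>
     (\<exists>A :: 'd \<Rightarrow> complex ^ 'd \<Rightarrow> complex ^ 'd \<Rightarrow> complex.
        (\<forall>r. psd_kernel poly_halfplane (A r)) \<and>
        (\<forall>z\<in>poly_halfplane. \<forall>w\<in>poly_halfplane.
           F z - cnj (F w) = (\<Sum>r\<in>UNIV. (z $ r - cnj (w $ r)) * A r z w)))}"

text \<open>Analyticity in several variables as complex Frechet differentiability, for open \<open>U\<close>.\<close>

definition analytic_multi :: "(complex ^ 'd \<Rightarrow> complex) \<Rightarrow> (complex ^ 'd) set \<Rightarrow> bool" where
  "analytic_multi f U \<longleftrightarrow>
     (\<forall>z\<in>U. \<exists>f'. (f has_derivative f') (at z) \<and> (\<forall>a h. f' (a *s h) = a * f' h))"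

definition schur_class :: "(complex ^ 'd \<Rightarrow> complex) set" where
  "schur_class = {f. analytic_multi f polydisc \<and> (\<forall>l\<in>polydisc. cmod (f l) \<le> 1)}"

definition alpha :: "complex \<Rightarrow> complex" where
  "alpha l = \<i> * (1 + l) / (1 - l)"

definition alpha_vec :: "complex ^ 'd \<Rightarrow> complex ^ 'd" where
  "alpha_vec l = (\<chi> r. alpha (l $ r))"

definition beta :: "complex \<Rightarrow> complex" where
  "beta z = (z - \<i>) / (z + \<i>)"

definition max_norm :: "complex ^ 'd \<Rightarrow> real" where
  "max_norm l = Max (range (\<lambda>r. cmod (l $ r)))"

definition B_point :: "(complex ^ 'd \<Rightarrow> complex) \<Rightarrow> complex ^ 'd \<Rightarrow> bool" where
  "B_point f t \<longleftrightarrow> t \<in> torus \<and> f \<in> schur_class \<and>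
     (\<exists>l :: nat \<Rightarrow> complex ^ 'd. (\<forall>n. l n \<in> polydisc) \<and> l \<longlonglongrightarrow> t \<and>
        bounded (range (\<lambda>n. (1 - cmod (f (l n))) / (1 - max_norm (l n)))))"

definition approach_region :: "complex ^ 'd \<Rightarrow> real \<Rightarrow> (complex ^ 'd) set" where
  "approach_region t c = {l \<in> polydisc. max_norm (l - t) \<le> c * (1 - max_norm l)}"

text \<open>A limit along this filter is a limit at \<open>t\<close> within the approach region of every aperture
  \<open>c\<close>.\<close>

definition nontangential :: "complex ^ 'd \<Rightarrow> (complex ^ 'd) filter" where
  "nontangential t = (SUP c. at t within approach_region t c)"

definition nt_value :: "(complex ^ 'd \<Rightarrow> complex) \<Rightarrow> complex ^ 'd \<Rightarrow> complex" where
  "nt_value f t = Lim (nontangential t) f"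

end

theory Submission
  imports Defs
begin

text \<open>Self-adjointness of \<open>X\<close> gives
  \<open>F z - cnj (F w) = \<langle>(z - w\<^sup>*) v\<^sub>z, v\<^sub>w\<rangle>\<close>; in particular \<open>Im (F (i y 1)) = y \<parallel>v\<^sub>i\<^sub>y\<parallel>\<^sup>2\<close>, so decay of
  \<open>F - C\<close> along the diagonal as in (i) makes \<open>y \<parallel>v\<^sub>i\<^sub>y\<parallel>\<close> bounded along a sequence, as in (iv).
  Since \<open>v\<^sub>i\<^sub>y - v\<close> lies in the domain and \<open>X (v\<^sub>i\<^sub>y - v) = i y v\<^sub>i\<^sub>y - z\<^sub>0 v\<close>, the functional
  \<open>x \<mapsto> \<langle>X x, v\<rangle>\<close> is then bounded, hence \<open>v\<close> is in the domain of the adjoint of \<open>X\<close>. For \<open>v\<close> in the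
  domain, \<open>v\<^sub>1 = (X - z\<^sub>0) v\<close> gives the representation (ii), and the other conditions follow from the
  resolvent bound \<open>1 / min (Im z\<^sup>r)\<close>. By the Cauchy-Schwarz inequality the same identity yields the
  Schwarz-Pick inequality for \<open>\<phi>\<close>, and passing to the limit along the sequence of the \<open>B\<close>-point a Julia
  inequality. It forces \<open>\<phi>\<close> to converge nontangentially at a linear rate to a unimodular value; if
  that value is not 1, undoing the Cayley transform gives (i).\<close>

section \<open>Complex Hilbert spaces\<close>

lemma cinner_add_right: "cinner x (y + z) = cinner x y + cinner x (z :: 'h::complex_hilbert)"
  by (metis cinner_add_left cinner_commute complex_cnj_add)

lemma cinner_scaleC_right: "cinner x (a *\<^sub>C y) = cnj a * cinner x (y :: 'h::complex_hilbert)"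
  by (metis cinner_scaleC_left cinner_commute complex_cnj_mult)

lemma cinner_self: "cinner x x = of_real ((norm (x :: 'h::complex_hilbert))\<^sup>2)"
proof (rule complex_eqI)
  show "Re (cinner x x) = Re (of_real ((norm x)\<^sup>2))"
    by (simp add: Re_cinner power2_norm_eq_inner)
  have "cinner x x = cnj (cinner x x)" by (rule cinner_commute)
  then show "Im (cinner x x) = Im (of_real ((norm x)\<^sup>2))"
    by (simp add: complex_eq_iff)
qed

lemma norm_scaleC: "norm (a *\<^sub>C x) = cmod a * norm (x :: 'h::complex_hilbert)"
proof -
  have "complex_of_real ((norm (a *\<^sub>C x))\<^sup>2) = a * cnj a * cinner x x"
    unfolding cinner_self[symmetric] by (simp add: cinner_scaleC_left cinner_scaleC_right)
  also have "\<dots> = of_real ((cmod a * norm x)\<^sup>2)"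
    unfolding cinner_self complex_norm_square[symmetric] by (simp add: power_mult_distrib)
  finally have "(norm (a *\<^sub>C x))\<^sup>2 = (cmod a * norm x)\<^sup>2" by (metis of_real_eq_iff)
  then show ?thesis by simp
qed

lemma norm_cinner_le: "cmod (cinner x y) \<le> norm x * norm (y :: 'h::complex_hilbert)"
proof (cases "cinner x y = 0")
  case False
  \<comment> \<open>The unimodular factor \<open>a\<close> rotates \<open>cinner x y\<close> onto
    the positive real axis, where the complex inner product equals the real one and the real
    Cauchy-Schwarz inequality applies.\<close>
  define a where "a = cnj (cinner x y) / cmod (cinner x y)"
  have a: "cmod a = 1" "a * cinner x y = of_real (cmod (cinner x y))"
    using False by (simp_all add: a_def norm_divide complex_norm_square[symmetric]
        power2_eq_square field_simps)
  have "cmod (cinner x y) = inner (a *\<^sub>C x) y"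
    using a(2) by (simp add: Re_cinner[symmetric] cinner_scaleC_left)
  also have "\<dots> \<le> norm (a *\<^sub>C x) * norm y" by (rule norm_cauchy_schwarz)
  finally show ?thesis by (simp add: norm_scaleC a)
qed simp

interpretation cinner: bounded_bilinear "cinner :: 'h::complex_hilbert \<Rightarrow> _"
proof
  show "\<exists>K. \<forall>a b :: 'h. norm (cinner a b) \<le> norm a * norm b * K"
    by (rule exI[of _ 1]) (simp add: norm_cinner_le)
qed (simp_all add: cinner_add_left cinner_add_right cinner_scaleC_left cinner_scaleC_right
    scaleR_conv_of_real flip: scaleC_of_real)

interpretation scaleC: bounded_bilinear "scaleC :: complex \<Rightarrow> 'h::complex_hilbert \<Rightarrow> 'h"
proof
  show "\<exists>K. \<forall>a (b :: 'h). norm (a *\<^sub>C b) \<le> norm a * norm b * K"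
    by (rule exI[of _ 1]) (simp add: norm_scaleC)
qed (simp_all add: scaleC_add_left scaleC_add_right scaleC_scaleC scaleR_conv_of_real mult.commute
    flip: scaleC_of_real)

text \<open>A complex-homogeneous functional is determined by its real part, since
  \<open>Im (f x) = - Re (f (\<i> *\<^sub>C x))\<close>. This lifts the real Riesz representation to
  the complex inner product.\<close>

lemma cinner_eqI_Re:
  fixes x y y' :: "'h::complex_hilbert"
  assumes "complex_vector.subspace S" "x \<in> S"
    and "\<And>a x. x \<in> S \<Longrightarrow> f (a *\<^sub>C x) = a * f x"
    and "\<And>x. x \<in> S \<Longrightarrow> Re (f x) = inner x y"
  shows "f x = cinner x y"
proof (rule complex_eqI)
  show "Re (f x) = Re (cinner x y)" using assms by (simp add: Re_cinner)
  have "\<i> *\<^sub>C x \<in> S" using assms(1,2) by (rule complex_vector.subspace_scale)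
  then have "Re (f (\<i> *\<^sub>C x)) = inner (\<i> *\<^sub>C x) y" by (rule assms(4))
  then show "Im (f x) = Im (cinner x y)"
    using assms by (simp add: Re_cinner[symmetric] cinner_scaleC_left)
qed

section \<open>Riesz representation on subspaces that need not be closed\<close>

text \<open>The representing vector is the limit of a minimising sequence of
  \<open>\<lambda>x. \<parallel>x\<parallel>\<^sup>2 / 2 - f x\<close> on \<open>S\<close>.\<close>

lemma riesz_on_subspace:
  fixes f :: "'a::{real_inner,complete_space} \<Rightarrow> real"
  assumes S: "subspace S"
    and add: "\<And>x y. x \<in> S \<Longrightarrow> y \<in> S \<Longrightarrow> f (x + y) = f x + f y"
    and scale: "\<And>a x. x \<in> S \<Longrightarrow> f (a *\<^sub>R x) = a * f x"
    and bound: "\<And>x. x \<in> S \<Longrightarrow> \<bar>f x\<bar> \<le> K * norm x"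
  obtains w where "w \<in> closure S" "\<And>x. x \<in> S \<Longrightarrow> f x = inner x w"
proof -
  define J where "J x = (norm x)\<^sup>2 / 2 - f x" for x
  have S0: "0 \<in> S" using S by (rule subspace_0)
  have lower: "- (K\<^sup>2 / 2) \<le> J x" if "x \<in> S" for x
  proof -
    have "0 \<le> (norm x - K)\<^sup>2" by simp
    then have "K * norm x \<le> (norm x)\<^sup>2 / 2 + K\<^sup>2 / 2"
      by (simp add: power2_diff field_simps)
    then show ?thesis using bound[OF that] by (simp add: J_def)
  qed
  define m where "m = Inf (J ` S)"
  have bdd: "bdd_below (J ` S)" using lower by (rule bdd_belowI2)
  have m: "m \<le> J x" if "x \<in> S" for x
    using that bdd by (simp add: m_def cInf_lower)
  have "\<exists>x\<in>S. J x < m + 1 / Suc n" for n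
    using cInf_lessD[of "J ` S" "m + 1 / Suc n"] S0 by (auto simp: m_def)
  then obtain s where s: "\<And>n. s n \<in> S" "\<And>n. J (s n) < m + 1 / Suc n" by metis
  have lim0: "(\<lambda>n. 1 / real (Suc n)) \<longlonglongrightarrow> 0"
    by (rule LIMSEQ_Suc[OF lim_1_over_n])
  have Js: "(\<lambda>n. J (s n)) \<longlonglongrightarrow> m"
  proof (rule tendsto_sandwich[of "\<lambda>_. m"])
    show "(\<lambda>n. m + 1 / real (Suc n)) \<longlonglongrightarrow> m" using tendsto_add[OF tendsto_const lim0, of m] by simp
  qed (use s m in \<open>auto intro!: always_eventually less_imp_le\<close>)
  \<comment> \<open>The parallelogram law, combined with the lower bound \<open>m\<close> for
    \<open>J\<close> at the midpoint, makes the minimising sequence Cauchy.\<close>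
  have mid: "(norm (x - y))\<^sup>2 / 4 \<le> J x + J y - 2 * m" if "x \<in> S" "y \<in> S" for x y
  proof -
    have xy: "(1/2) *\<^sub>R (x + y) \<in> S" using that S by (simp add: subspace_add subspace_scale)
    have "J ((1/2) *\<^sub>R (x + y)) = (norm (x + y))\<^sup>2 / 8 - (f x + f y) / 2"
      using that S by (simp add: J_def add scale subspace_add power_divide)
    moreover have "(norm (x - y))\<^sup>2 + (norm (x + y))\<^sup>2 = 2 * (norm x)\<^sup>2 + 2 * (norm y)\<^sup>2"
      by (simp add: power2_norm_eq_inner inner_diff inner_add inner_commute)
    ultimately show ?thesis using m[OF xy] by (simp add: J_def field_simps)
  qed
  have "Cauchy s"
  proof (rule CauchyI)
    fix e :: real assume "0 < e"
    then have "0 < e\<^sup>2 / 8" by simp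
    then have "\<forall>\<^sub>F n in sequentially. J (s n) < m + e\<^sup>2 / 8"
      using Js by (intro order_tendstoD(2)[of _ m]) auto
    then obtain N where N: "\<And>n. n \<ge> N \<Longrightarrow> J (s n) < m + e\<^sup>2 / 8"
      by (auto simp: eventually_sequentially)
    have "norm (s i - s j) < e" if "i \<ge> N" "j \<ge> N" for i j
    proof -
      have "(norm (s i - s j))\<^sup>2 < e\<^sup>2"
        using mid[OF s(1)[of i] s(1)[of j]] N[OF that(1)] N[OF that(2)] by simp
      then show ?thesis using \<open>0 < e\<close> by (simp add: power_less_imp_less_base)
    qed
    then show "\<exists>N. \<forall>i\<ge>N. \<forall>j\<ge>N. norm (s i - s j) < e" by blast
  qed
  then obtain w where w: "s \<longlonglongrightarrow> w" by (auto simp: Cauchy_convergent_iff convergent_def)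
  have "f x = inner x w" if x: "x \<in> S" for x
  proof -
    \<comment> \<open>\<open>b\<close> is the first variation of \<open>J\<close> at
      \<open>w\<close> in the direction \<open>x\<close>. As \<open>w\<close> may lie outside
      \<open>S\<close>, its minimality is used in the limit along \<open>s\<close>.\<close>
    define b where "b = inner w x - f x"
    have ineq: "0 \<le> t * b + t\<^sup>2 * (norm x)\<^sup>2 / 2" for t
    proof -
      have "(norm (s n + t *\<^sub>R x))\<^sup>2 = (norm (s n))\<^sup>2 + 2 * t * inner (s n) x + t\<^sup>2 * (norm x)\<^sup>2" for n
        unfolding power2_norm_eq_inner
        by (simp add: inner_commute power2_eq_square algebra_simps)
      then have "J (s n + t *\<^sub>R x) = J (s n) + t * (inner (s n) x - f x) + t\<^sup>2 * (norm x)\<^sup>2 / 2" for n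
        using x s(1)[of n] S
        by (simp add: J_def add scale subspace_scale field_simps)
      then have "m \<le> J (s n) + t * (inner (s n) x - f x) + t\<^sup>2 * (norm x)\<^sup>2 / 2" for n
        using m[of "s n + t *\<^sub>R x"] x s(1)[of n] S by (simp add: subspace_add subspace_scale)
      moreover have "(\<lambda>n. J (s n) + t * (inner (s n) x - f x) + t\<^sup>2 * (norm x)\<^sup>2 / 2)
          \<longlonglongrightarrow> m + t * b + t\<^sup>2 * (norm x)\<^sup>2 / 2"
        unfolding b_def by (intro tendsto_intros Js w) simp_all
      ultimately have "m \<le> m + t * b + t\<^sup>2 * (norm x)\<^sup>2 / 2"
        by (intro tendsto_lowerbound[OF _ always_eventually]) auto
      then show ?thesis by simp
    qed
    have "b = 0"
    proof (rule ccontr)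
      assume "b \<noteq> 0"
      \<comment> \<open>At \<open>t = - b / q\<close> the linear term outweighs the quadratic one.
        The summand 1 keeps \<open>q\<close> positive for \<open>x = 0\<close> as well.\<close>
      define q where "q = (norm x)\<^sup>2 + 1"
      have q: "q > 0" by (simp add: q_def add_nonneg_pos)
      have "0 \<le> (- b / q) * b + (- b / q)\<^sup>2 * (norm x)\<^sup>2 / 2" by (rule ineq)
      also have "\<dots> \<le> (- b / q) * b + (- b / q)\<^sup>2 * q / 2"
        by (intro add_left_mono divide_right_mono mult_left_mono) (simp_all add: q_def)
      also have "\<dots> = - (b\<^sup>2 / (2 * q))" using q by (simp add: field_simps power2_eq_square)
      also have "\<dots> < 0" using q \<open>b \<noteq> 0\<close> by simp
      finally show False by simp
    qed
    then show ?thesis by (simp add: b_def inner_commute)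
  qed
  moreover have "w \<in> closure S" using s(1) w by (auto simp: closure_sequential)
  ultimately show thesis using that by blast
qed

lemma subspace_complex_imp_real:
  "complex_vector.subspace S \<Longrightarrow> subspace (S :: 'h::complex_hilbert set)"
  by (auto simp: complex_vector.subspace_def subspace_def simp flip: scaleC_of_real)

section \<open>Resolvents of self-adjoint operators\<close>

locale decomposed_space =
  fixes M :: "'d::finite \<Rightarrow> 'h::complex_hilbert set"
  assumes orthogonal_decomposition: "orthogonal_decomposition M"
begin

abbreviation comp :: "'h \<Rightarrow> 'd \<Rightarrow> 'h" where "comp \<equiv> components M"
abbreviation pt :: "complex ^ 'd \<Rightarrow> 'h \<Rightarrow> 'h" where "pt \<equiv> point_op M"

lemma subspace: "complex_vector.subspace (M r)"
  and orthogonal: "r \<noteq> s \<Longrightarrow> x \<in> M r \<Longrightarrow> y \<in> M s \<Longrightarrow> cinner x y = 0"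
  using orthogonal_decomposition by (auto simp: orthogonal_decomposition_def)

lemma components_eqI:
  assumes u: "\<And>r. u r \<in> M r" and x: "x = (\<Sum>r\<in>UNIV. u r)"
  shows "comp x = u"
  unfolding components_def
proof (rule the_equality)
  fix u' assume u': "(\<forall>r. u' r \<in> M r) \<and> x = (\<Sum>r\<in>UNIV. u' r)"
  show "u' = u"
  proof
    fix r
    have mem: "u' s - u s \<in> M s" for s
      using u u' subspace complex_vector.subspace_diff by blast
    \<comment> \<open>Two decompositions of \<open>x\<close> differ by a family with sum 0; pairing
      this sum with one member leaves only the square of that member's norm.\<close>
    have "0 = cinner (u' r - u r) (\<Sum>s\<in>UNIV. u' s - u s)"
      using x u' by (simp add: sum_subtractf cinner.zero_right)
    also have "\<dots> = (\<Sum>s\<in>UNIV. if s = r then cinner (u' r - u r) (u' r - u r) else 0)"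
      unfolding cinner.sum_right
      by (intro sum.cong refl) (use mem orthogonal in \<open>metis (full_types)\<close>)
    finally show "u' r = u r" by (simp add: cinner_self)
  qed
qed (use assms in blast)

lemma component_in: "comp x r \<in> M r"
  and sum_components: "(\<Sum>r\<in>UNIV. comp x r) = x"
proof -
  obtain u where "\<And>r. u r \<in> M r" "x = (\<Sum>r\<in>UNIV. u r)"
    using orthogonal_decomposition unfolding orthogonal_decomposition_def by blast
  then show "comp x r \<in> M r" "(\<Sum>r\<in>UNIV. comp x r) = x" using components_eqI by metis+
qed

lemma component_add: "comp (x + y) r = comp x r + comp y r"
proof -
  have "comp (x + y) = (\<lambda>r. comp x r + comp y r)"
    by (rule components_eqI)
      (simp_all add: complex_vector.subspace_add subspace component_in sum.distrib sum_components)
  then show ?thesis by simp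
qed

lemma component_point_op: "comp (pt z x) r = (z $ r) *\<^sub>C comp x r"
proof -
  have "comp (pt z x) = (\<lambda>r. (z $ r) *\<^sub>C comp x r)"
    by (rule components_eqI)
      (simp_all add: complex_vector.subspace_scale subspace component_in point_op_def)
  then show ?thesis by simp
qed

lemma point_op_vec: "pt (vec a) x = a *\<^sub>C x"
  by (simp add: point_op_def scaleC.sum_right[symmetric] sum_components)

lemma component_scaleC: "comp (a *\<^sub>C x) r = a *\<^sub>C comp x r"
  using component_point_op[of "vec a" x r] by (simp add: point_op_vec)

lemma cinner_components: "cinner x y = (\<Sum>r\<in>UNIV. cinner (comp x r) (comp y r))"
proof -
  have "cinner x y = cinner (\<Sum>r\<in>UNIV. comp x r) (\<Sum>s\<in>UNIV. comp y s)"
    by (simp add: sum_components)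
  also have "\<dots> = (\<Sum>r\<in>UNIV. \<Sum>s\<in>UNIV. if s = r then cinner (comp x r) (comp y s) else 0)"
    unfolding cinner.sum_right cinner.sum_left
    by (subst sum.swap, intro sum.cong refl) (use component_in orthogonal in metis)
  finally show ?thesis by simp
qed

lemma norm_components: "(norm x)\<^sup>2 = (\<Sum>r\<in>UNIV. (norm (comp x r))\<^sup>2)"
proof -
  have "complex_of_real ((norm x)\<^sup>2) = of_real (\<Sum>r\<in>UNIV. (norm (comp x r))\<^sup>2)"
    unfolding cinner_self[symmetric] of_real_sum by (rule cinner_components)
  then show ?thesis by (metis of_real_eq_iff)
qed

lemma cinner_point_op: "cinner (pt z x) y = (\<Sum>r\<in>UNIV. z $ r * cinner (comp x r) (comp y r))"
  by (subst cinner_components) (simp add: component_point_op cinner_scaleC_left)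

lemma cinner_point_op_adjoint: "cinner (pt z x) y = cinner x (pt (cnj_vec z) y)"
  unfolding cinner_point_op
  by (subst cinner_components) (simp add: component_point_op cinner_scaleC_right cnj_vec_def)

lemma cnj_cinner_point_op: "cnj (cinner (pt z x) y) = cinner (pt (cnj_vec z) y) x"
  using cinner_commute[of y "pt z x"] by (simp add: cinner_point_op_adjoint cnj_vec_def)

lemma Im_cinner_point_op: "Im (cinner (pt z x) x) = (\<Sum>r\<in>UNIV. Im (z $ r) * (norm (comp x r))\<^sup>2)"
  by (simp add: cinner_point_op cinner_self Im_sum flip: of_real_power)

lemma norm_point_op_le: "norm (pt z x) \<le> norm z * norm x"
proof (rule power2_le_imp_le)
  have "(norm (pt z x))\<^sup>2 = (\<Sum>r\<in>UNIV. (cmod (z $ r))\<^sup>2 * (norm (comp x r))\<^sup>2)"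
    by (subst norm_components) (simp add: component_point_op norm_scaleC power_mult_distrib)
  also have "\<dots> \<le> (\<Sum>r\<in>UNIV. (norm z)\<^sup>2 * (norm (comp x r))\<^sup>2)"
    by (intro sum_mono mult_right_mono power_mono Finite_Cartesian_Product.norm_nth_le) simp_all
  also have "\<dots> = (norm z * norm x)\<^sup>2"
    by (simp add: norm_components[of x] power_mult_distrib sum_distrib_left)
  finally show "(norm (pt z x))\<^sup>2 \<le> (norm z * norm x)\<^sup>2" .
qed simp

sublocale point_op: bounded_bilinear "point_op M"
proof
  show "\<exists>K. \<forall>a b. norm (pt a b) \<le> norm a * norm b * K"
    by (rule exI[of _ 1]) (simp add: norm_point_op_le)
  show "pt (z + w) x = pt z x + pt w x" for z w x
    by (simp add: point_op_def scaleC_add_left sum.distrib)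
  show "pt z (x + y) = pt z x + pt z y" for z x y
    by (simp add: point_op_def component_add scaleC_add_right sum.distrib)
  show "pt (a *\<^sub>R z) x = a *\<^sub>R pt z x" for a z x
    by (simp add: point_op_def scaleC.scaleR_left scaleR_sum_right)
  show "pt z (a *\<^sub>R x) = a *\<^sub>R pt z x" for a z x
    by (simp add: point_op_def component_scaleC scaleC.scaleR_right scaleR_sum_right
        flip: scaleC_of_real)
      (simp add: scaleC_scaleC complex_vector.scale_sum_right mult.commute)
qed

lemma point_op_scaleC: "pt z (a *\<^sub>C x) = a *\<^sub>C pt z x"
  by (simp add: point_op_def component_scaleC scaleC_scaleC complex_vector.scale_sum_right mult.commute)

lemma point_op_scale_left: "pt (a *s z) x = a *\<^sub>C pt z x"
  by (simp add: point_op_def scaleC_scaleC complex_vector.scale_sum_right)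

end

section \<open>Self-adjoint operators: invertibility of \<open>X - z\<close> and properties of its
  inverse\<close>

locale self_adjoint_operator = decomposed_space M
  for M :: "'d::finite \<Rightarrow> 'h::complex_hilbert set" +
  fixes D :: "'h set" and X :: "'h \<Rightarrow> 'h"
  assumes self_adjoint: "self_adjoint D X"
begin

abbreviation R :: "complex ^ 'd \<Rightarrow> 'h \<Rightarrow> 'h" where "R \<equiv> resolvent M D X"

lemma subspace_dom: "complex_vector.subspace D"
  and op_add: "x \<in> D \<Longrightarrow> y \<in> D \<Longrightarrow> X (x + y) = X x + X y"
  and op_scaleC: "x \<in> D \<Longrightarrow> X (a *\<^sub>C x) = a *\<^sub>C X x"
  and adjoint_graph: "adjoint_graph D X = (\<lambda>x. (x, X x)) ` D"
  using self_adjoint by (auto simp: self_adjoint_def densely_defined_operator_def)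

text \<open>The half of self-adjointness that goes beyond symmetry: the adjoint is no larger than
  \<open>X\<close>. It puts limits and representing vectors into \<open>D\<close>.\<close>

lemma in_domI:
  assumes "\<And>x. x \<in> D \<Longrightarrow> cinner (X x) y = cinner x w"
  shows "y \<in> D" "X y = w"
proof -
  have "(y, w) \<in> (\<lambda>x. (x, X x)) ` D"
    unfolding adjoint_graph[symmetric] using assms by (simp add: adjoint_graph_def)
  then show "y \<in> D" "X y = w" by auto
qed

lemma symmetric: "x \<in> D \<Longrightarrow> y \<in> D \<Longrightarrow> cinner (X x) y = cinner x (X y)"
  using adjoint_graph by (auto simp: adjoint_graph_def set_eq_iff)

lemma op_diff: "x \<in> D \<Longrightarrow> y \<in> D \<Longrightarrow> X (x - y) = X x - X y"
  using op_add[of "x - y" y] subspace_dom complex_vector.subspace_diff by fastforce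

lemma Im_cinner_op: "x \<in> D \<Longrightarrow> Im (cinner (X x) x) = 0"
  using symmetric[of x x] cinner_commute[of x "X x"]
  by (metis Reals_cnj_iff complex_is_Real_iff)

text \<open>Since \<open>cinner (X x) x\<close> is real, the imaginary part of
  \<open>cinner (X x - pt z x) x\<close> comes from \<open>z\<close> alone; Cauchy-Schwarz bounds it
  from above.\<close>

lemma op_minus_point_lower:
  assumes x: "x \<in> D" and \<delta>: "\<And>r. \<delta> \<le> Im (z $ r)"
  shows "\<delta> * norm x \<le> norm (X x - pt z x)"
proof (cases "x = 0")
  case False
  have "\<delta> * (norm x)\<^sup>2 = (\<Sum>r\<in>UNIV. \<delta> * (norm (comp x r))\<^sup>2)"
    by (simp add: norm_components[of x] sum_distrib_left)
  also have "\<dots> \<le> Im (cinner (pt z x) x)"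
    unfolding Im_cinner_point_op by (intro sum_mono mult_right_mono \<delta>) simp
  also have "\<dots> = - Im (cinner (X x - pt z x) x)"
    using x by (simp add: cinner.diff_left Im_cinner_op)
  also have "\<dots> \<le> norm (X x - pt z x) * norm x"
    using norm_cinner_le[of "X x - pt z x" x] abs_Im_le_cmod[of "cinner (X x - pt z x) x"] by linarith
  finally show ?thesis using False by (simp add: power2_eq_square)
qed simp

lemma point_halfplane_bound:
  assumes "z \<in> poly_halfplane"
  obtains \<delta> where "\<delta> > 0" "\<And>r. \<delta> \<le> Im (z $ r)"
proof
  show "Min (range (\<lambda>r. Im (z $ r))) > 0"
    using assms by (subst Min_gr_iff) (auto simp: poly_halfplane_def)
  show "Min (range (\<lambda>r. Im (z $ r))) \<le> Im (z $ r)" for r by (intro Min_le) auto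
qed

text \<open>Here \<open>x\<close> spans a direction orthogonal to the range of \<open>X - z\<close>;
  that there is none besides 0 makes the range dense. The imaginary part of
  \<open>cinner (X x) x\<close> decides again.\<close>

lemma adjoint_injective:
  assumes z: "z \<in> poly_halfplane" and x: "x \<in> D" "X x = pt (cnj_vec z) x"
  shows "x = 0"
proof -
  obtain \<delta> where \<delta>: "\<delta> > 0" "\<And>r. \<delta> \<le> Im (z $ r)" using point_halfplane_bound[OF z] by blast
  have "\<delta> * (norm x)\<^sup>2 = (\<Sum>r\<in>UNIV. \<delta> * (norm (comp x r))\<^sup>2)"
    by (simp add: norm_components[of x] sum_distrib_left)
  also have "\<dots> \<le> (\<Sum>r\<in>UNIV. Im (z $ r) * (norm (comp x r))\<^sup>2)"
    by (intro sum_mono mult_right_mono \<delta>) simp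
  also have "\<dots> = - Im (cinner (pt (cnj_vec z) x) x)"
    unfolding Im_cinner_point_op by (simp add: cnj_vec_def sum_negf)
  also have "\<dots> = 0" using Im_cinner_op[OF x(1)] x(2) by simp
  finally show ?thesis using \<delta>(1) by (simp add: mult_le_0_iff)
qed

text \<open>The lower bound turns a convergent sequence of images into a Cauchy sequence of
  preimages, and \<open>X\<close> is closed because it equals its adjoint.\<close>

lemma op_minus_point_range_closed:
  assumes z: "z \<in> poly_halfplane"
  shows "closed ((\<lambda>x. X x - pt z x) ` D)" (is "closed ?S")
  unfolding closed_sequential_limits
proof (intro allI impI, elim conjE)
  fix h l assume "\<forall>n. h n \<in> ?S" and h: "h \<longlonglongrightarrow> l"
  then obtain u where u: "\<And>n. u n \<in> D" "\<And>n. h n = X (u n) - pt z (u n)"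
    by (simp add: image_iff) metis
  obtain \<delta> where \<delta>: "\<delta> > 0" "\<And>r. \<delta> \<le> Im (z $ r)" using point_halfplane_bound[OF z] by blast
  have "Cauchy u"
  proof (rule CauchyI)
    fix e :: real assume "0 < e"
    then have "0 < e * \<delta>" using \<delta> by simp
    then obtain N where N: "\<And>i j. i \<ge> N \<Longrightarrow> j \<ge> N \<Longrightarrow> norm (h i - h j) < e * \<delta>"
      using LIMSEQ_imp_Cauchy[OF h] unfolding Cauchy_iff by blast
    have "norm (u i - u j) < e" if "i \<ge> N" "j \<ge> N" for i j
    proof -
      have "\<delta> * norm (u i - u j) \<le> norm (X (u i - u j) - pt z (u i - u j))"
        using \<delta> u(1) subspace_dom by (intro op_minus_point_lower complex_vector.subspace_diff)
      also have "\<dots> = norm (h i - h j)"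
        by (simp add: u(2) op_diff[OF u(1) u(1)] point_op.diff_right algebra_simps)
      also have "\<dots> < e * \<delta>" using N that by blast
      finally show ?thesis using \<delta>(1) by (simp add: mult.commute)
    qed
    then show "\<exists>N. \<forall>i\<ge>N. \<forall>j\<ge>N. norm (u i - u j) < e" by blast
  qed
  then obtain w where w: "u \<longlonglongrightarrow> w" by (auto simp: Cauchy_convergent_iff convergent_def)
  have "cinner (X x) w = cinner x (l + pt z w)" if x: "x \<in> D" for x
  proof (rule LIMSEQ_unique)
    show "(\<lambda>n. cinner (X x) (u n)) \<longlonglongrightarrow> cinner (X x) w" by (intro cinner.tendsto tendsto_const w)
    have "(\<lambda>n. cinner x (h n + pt z (u n))) \<longlonglongrightarrow> cinner x (l + pt z w)"
      by (intro cinner.tendsto point_op.tendsto tendsto_intros w h)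
    moreover have "h n + pt z (u n) = X (u n)" for n by (simp add: u)
    ultimately show "(\<lambda>n. cinner (X x) (u n)) \<longlonglongrightarrow> cinner x (l + pt z w)"
      using x u(1) by (simp add: symmetric)
  qed
  from in_domI[OF this] show "l \<in> ?S" by force
qed

text \<open>The range is closed, and its orthogonal complement lies in the kernel of
  \<open>X - z\<^sup>*\<close>, which is trivial.\<close>

lemma op_minus_point_surj:
  assumes z: "z \<in> poly_halfplane"
  shows "(\<lambda>x. X x - pt z x) ` D = UNIV" (is "?S = UNIV")
proof (rule UNIV_eq_I[symmetric])
  fix h
  have lin: "X (a *\<^sub>C x) - pt z (a *\<^sub>C x) = a *\<^sub>C (X x - pt z x)" if "x \<in> D" for a x
    using that by (simp add: op_scaleC point_op_scaleC complex_vector.scale_right_diff_distrib)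
  have sub: "complex_vector.subspace ?S"
  proof (rule complex_vector.subspaceI)
    have "0 \<in> D" using subspace_dom by (rule complex_vector.subspace_0)
    then show "0 \<in> ?S" using lin[of 0 0] by (intro image_eqI[of _ _ 0]) simp_all
    show "x + y \<in> ?S" if "x \<in> ?S" "y \<in> ?S" for x y
    proof -
      from that obtain a b where ab: "a \<in> D" "x = X a - pt z a" "b \<in> D" "y = X b - pt z b" by blast
      then show ?thesis using complex_vector.subspace_add[OF subspace_dom ab(1,3)]
        by (intro image_eqI[of _ _ "a + b"]) (simp_all add: op_add point_op.add_right)
    qed
    show "c *\<^sub>C x \<in> ?S" if "x \<in> ?S" for c x
    proof -
      from that obtain a where a: "a \<in> D" "x = X a - pt z a" by blast
      then show ?thesis using complex_vector.subspace_scale[OF subspace_dom a(1)] lin[OF a(1)]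
        by (intro image_eqI[of _ _ "c *\<^sub>C a"]) simp_all
    qed
  qed
  \<comment> \<open>\<open>w\<close> is the orthogonal projection of \<open>h\<close> onto the
    closure of the range, so \<open>h - w\<close> is orthogonal to the range.\<close>
  obtain w where w: "w \<in> closure ?S" "\<And>x. x \<in> ?S \<Longrightarrow> inner x h = inner x w"
  proof (rule riesz_on_subspace[OF subspace_complex_imp_real[OF sub], of "\<lambda>x. inner x h" "norm h"])
    show "\<bar>inner x h\<bar> \<le> norm h * norm x" for x
      using Cauchy_Schwarz_ineq2[of x h] by (simp add: mult.commute)
  qed (auto simp: inner_add_left)
  have "cinner (X x) (h - w) = cinner x (pt (cnj_vec z) (h - w))" if "x \<in> D" for x
  proof -
    have S: "X x - pt z x \<in> ?S" using that by blast
    have "cinner (X x - pt z x) h = cinner (X x - pt z x) w"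
    proof (rule cinner_eqI_Re[OF sub S, where f = "\<lambda>x. cinner x h"])
      show "Re (cinner x h) = inner x w" if "x \<in> ?S" for x
        using w(2)[OF that] by (simp add: Re_cinner)
    qed (simp add: cinner_scaleC_left)
    then show ?thesis
      unfolding cinner_point_op_adjoint[symmetric] by (simp add: cinner.diff_left cinner.diff_right algebra_simps)
  qed
  from in_domI[OF this] have "h - w = 0" by (rule adjoint_injective[OF z])
  then show "h \<in> ?S" using w(1) op_minus_point_range_closed[OF z] by (simp add: closure_closed)
qed

text \<open>Replaces the choice in \<open>inv_into\<close> by a genuine inverse: surjectivity gives
  the first two claims, injectivity from the lower bound gives the third.\<close>

lemma
  assumes z: "z \<in> poly_halfplane"
  shows resolvent_dom: "R z h \<in> D"
    and op_resolvent: "X (R z h) = h + pt z (R z h)"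
    and resolvent_op: "x \<in> D \<Longrightarrow> R z (X x - pt z x) = x"
proof -
  have h: "h \<in> (\<lambda>x. X x - pt z x) ` D" by (simp add: op_minus_point_surj[OF z])
  from inv_into_into[OF this] show "R z h \<in> D" by (simp add: resolvent_def)
  from f_inv_into_f[OF h] show "X (R z h) = h + pt z (R z h)"
    by (simp add: resolvent_def algebra_simps)
  obtain \<delta> where \<delta>: "\<delta> > 0" "\<And>r. \<delta> \<le> Im (z $ r)" using point_halfplane_bound[OF z] by blast
  have "inj_on (\<lambda>x. X x - pt z x) D"
  proof (rule inj_onI)
    fix x y assume xy: "x \<in> D" "y \<in> D" "X x - pt z x = X y - pt z y"
    have "\<delta> * norm (x - y) \<le> norm (X (x - y) - pt z (x - y))"
      using \<delta> xy subspace_dom by (intro op_minus_point_lower complex_vector.subspace_diff)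
    also have "\<dots> = 0" using xy by (simp add: op_diff point_op.diff_right algebra_simps)
    finally show "x = y" using \<delta>(1) by (simp add: mult_le_0_iff)
  qed
  then show "x \<in> D \<Longrightarrow> R z (X x - pt z x) = x"
    by (simp add: resolvent_def inv_into_f_f[of "\<lambda>x. X x - pt z x"])
qed

lemma norm_resolvent_le:
  assumes "\<delta> > 0" "\<And>r. \<delta> \<le> Im (z $ r)"
  shows "norm (R z h) \<le> norm h / \<delta>"
proof -
  have z: "z \<in> poly_halfplane"
    using assms by (auto simp: poly_halfplane_def intro: less_le_trans)
  show ?thesis
    using op_minus_point_lower[OF resolvent_dom[OF z, of h] assms(2)] assms(1)
    by (simp add: op_resolvent[OF z] field_simps)
qed

text \<open>Apply \<open>X - z\<close> to the difference. The operator of \<open>z - w\<close> need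
  not commute with the resolvents, so it stays between them.\<close>

lemma resolvent_identity:
  assumes z: "z \<in> poly_halfplane" and w: "w \<in> poly_halfplane"
  shows "R z h - R w h = R z (pt (z - w) (R w h))"
proof -
  have "X (R z h - R w h) - pt z (R z h - R w h) = pt (z - w) (R w h)"
    by (simp add: op_diff resolvent_dom op_resolvent z w point_op.diff_right point_op.diff_left)
  then show ?thesis
    using resolvent_op[OF z, of "R z h - R w h"] complex_vector.subspace_diff[OF subspace_dom]
    by (simp add: resolvent_dom z w)
qed

lemma resolvent_add: "z \<in> poly_halfplane \<Longrightarrow> R z (g + h) = R z g + R z h"
  using resolvent_op[of z "R z g + R z h"] complex_vector.subspace_add[OF subspace_dom, of "R z g" "R z h"]
  by (simp add: resolvent_dom op_add op_resolvent point_op.add_right algebra_simps)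

lemma resolvent_scaleC: "z \<in> poly_halfplane \<Longrightarrow> R z (a *\<^sub>C h) = a *\<^sub>C R z h"
  using resolvent_op[of z "a *\<^sub>C R z h"] complex_vector.subspace_scale[OF subspace_dom, of "R z h" a]
  by (simp add: resolvent_dom op_scaleC op_resolvent point_op_scaleC complex_vector.scale_right_distrib)

lemma bounded_linear_resolvent:
  assumes z: "z \<in> poly_halfplane"
  shows "bounded_linear (R z)"
proof -
  obtain \<delta> where \<delta>: "\<delta> > 0" "\<And>r. \<delta> \<le> Im (z $ r)" using point_halfplane_bound[OF z] by blast
  show ?thesis
  proof (rule bounded_linear_intro)
    show "norm (R z h) \<le> norm h * (1 / \<delta>)" for h using norm_resolvent_le[OF \<delta>] by simp
  qed (simp_all add: resolvent_add resolvent_scaleC z flip: scaleC_of_real)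
qed

text \<open>Riesz represents the functional by a vector, which puts \<open>y\<close> into the domain
  of the adjoint, that is, into \<open>D\<close>.\<close>

lemma in_dom_if_functional_bounded:
  assumes "\<And>x. x \<in> D \<Longrightarrow> cmod (cinner (X x) y) \<le> K * norm x"
  shows "y \<in> D"
proof -
  obtain w where w: "\<And>x. x \<in> D \<Longrightarrow> inner (X x) y = inner x w"
  proof (rule riesz_on_subspace[OF subspace_complex_imp_real[OF subspace_dom], of "\<lambda>x. inner (X x) y" K])
    show "inner (X (x + x')) y = inner (X x) y + inner (X x') y" if "x \<in> D" "x' \<in> D" for x x'
      using that by (simp add: op_add inner_add_left)
    show "inner (X (a *\<^sub>R x)) y = a * inner (X x) y" if "x \<in> D" for a x
      using op_scaleC[OF that, of "of_real a"] by (simp add: scaleC_of_real)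
    show "\<bar>inner (X x) y\<bar> \<le> K * norm x" if "x \<in> D" for x
      using assms[OF that] abs_Re_le_cmod[of "cinner (X x) y"] by (simp add: Re_cinner)
  qed blast
  have "cinner (X x) y = cinner x w" if "x \<in> D" for x
  proof (rule cinner_eqI_Re[OF subspace_dom that, where f = "\<lambda>x. cinner (X x) y"])
    show "Re (cinner (X x) y) = inner x w" if "x \<in> D" for x
      using w[OF that] by (simp add: Re_cinner)
  qed (simp add: op_scaleC cinner_scaleC_left)
  then show ?thesis by (rule in_domI)
qed

text \<open>Two applications of the resolvent identity leave a remainder with two factors
  \<open>y - z\<close>, hence one of second order.\<close>

lemma cinner_resolvent_has_derivative:
  assumes z: "z \<in> poly_halfplane"
  shows "((\<lambda>z. cinner (R z g) k) has_derivative (\<lambda>h. cinner (R z (pt h (R z g))) k)) (at z)"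
proof -
  obtain \<delta> where \<delta>: "\<delta> > 0" "\<And>r. \<delta> \<le> Im (z $ r)" using point_halfplane_bound[OF z] by blast
  \<comment> \<open>The remainder estimate divided by \<open>norm (y - z)\<close>: each of the two
    factors \<open>R z\<close> costs \<open>1 / \<delta>\<close>, and \<open>R y\<close> costs
    \<open>2 / \<delta>\<close>, because \<open>y\<close> stays within \<open>\<delta> / 2\<close>
    of \<open>z\<close>.\<close>
  define H where "H y = 2 / \<delta> * (norm g / \<delta> / \<delta>) * norm k * norm (y - z)" for y
  show ?thesis
  proof (rule has_derivativeI_sandwich)
    show "0 < \<delta> / 2" using \<delta> by simp
    show "bounded_linear (\<lambda>h. cinner (R z (pt h (R z g))) k)"
      by (intro bounded_linear_compose[OF cinner.bounded_linear_left]
          bounded_linear_compose[OF bounded_linear_resolvent[OF z]] point_op.bounded_linear_left)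
    have "(H \<longlongrightarrow> 2 / \<delta> * (norm g / \<delta> / \<delta>) * norm k * norm (z - z)) (at z)"
      unfolding H_def by (intro tendsto_intros)
    then show "(H \<longlongrightarrow> 0) (at z)" by simp
    fix y assume y: "y \<noteq> z" "dist y z < \<delta> / 2"
    have Im_y: "\<delta> / 2 \<le> Im (y $ r)" for r
    proof -
      have "\<bar>Im (y $ r) - Im (z $ r)\<bar> \<le> norm (y - z)"
        using abs_Im_le_cmod[of "y $ r - z $ r"] Finite_Cartesian_Product.norm_nth_le[of "y - z" r] by simp
      then show ?thesis using \<delta>(2)[of r] y(2) by (simp add: dist_norm)
    qed
    then have y': "y \<in> poly_halfplane" using \<delta>(1) by (auto simp: poly_halfplane_def intro: less_le_trans[of _ "\<delta> / 2"])
    interpret Rz: bounded_linear "R z" by (rule bounded_linear_resolvent[OF z])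
    define q where "q = pt (y - z) (R z g)"
    have "R y g - R z g - R z q = R y q - R z q"
      using resolvent_identity[OF y' z, of g] by (simp add: q_def)
    also have "\<dots> = R y (pt (y - z) (R z q))" by (rule resolvent_identity[OF y' z])
    finally have eq: "cinner (R y g) k - cinner (R z g) k - cinner (R z q) k = cinner (R y (pt (y - z) (R z q))) k"
      by (simp flip: cinner.diff_left)
    have nq: "norm q \<le> norm (y - z) * (norm g / \<delta>)"
      unfolding q_def using norm_resolvent_le[OF \<delta>, of g]
      by (intro order_trans[OF norm_point_op_le] mult_left_mono) auto
    have "norm (R y (pt (y - z) (R z q))) \<le> norm (pt (y - z) (R z q)) / (\<delta> / 2)"
      using \<delta>(1) Im_y by (intro norm_resolvent_le) auto
    also have "\<dots> \<le> (norm (y - z) * (norm (y - z) * (norm g / \<delta>) / \<delta>)) / (\<delta> / 2)"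
    proof (intro divide_right_mono order_trans[OF norm_point_op_le] mult_left_mono)
      show "norm (R z q) \<le> norm (y - z) * (norm g / \<delta>) / \<delta>"
        using nq \<delta>(1) by (intro order_trans[OF norm_resolvent_le[OF \<delta>]] divide_right_mono) auto
    qed (use \<delta>(1) in auto)
    finally have "cmod (cinner (R y (pt (y - z) (R z q))) k)
        \<le> (norm (y - z) * (norm (y - z) * (norm g / \<delta>) / \<delta>)) / (\<delta> / 2) * norm k"
      by (intro order_trans[OF norm_cinner_le] mult_right_mono) auto
    also have "\<dots> = H y * norm (y - z)" using \<delta>(1) by (simp add: H_def field_simps)
    finally show "cmod (cinner (R y g) k - cinner (R z g) k - cinner (R z (pt (y - z) (R z g))) k) / norm (y - z) \<le> H y"
      unfolding eq q_def[symmetric] using y(1) by (simp add: divide_le_eq)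
  qed
qed

end

section \<open>Cayley transforms\<close>

text \<open>The Cayley transform carries the disc expression \<open>1 - l * cnj m\<close> to the
  half-plane expression \<open>z - cnj w\<close>. The case \<open>l = m\<close> yields the formula
  for \<open>Im (alpha l)\<close>, the general case transfers Schwarz-Pick.\<close>

lemma alpha_plus_cnj_alpha:
  assumes "cmod l < 1" "cmod m < 1"
  shows "alpha l - cnj (alpha m) = 2 * \<i> * (1 - l * cnj m) / ((1 - l) * cnj (1 - m))"
proof -
  have "l \<noteq> 1" "m \<noteq> 1" using assms by auto
  then have "1 - l \<noteq> 0" "1 - cnj m \<noteq> 0" by simp_all
  then show ?thesis by (simp add: alpha_def field_simps)
qed

lemma Im_alpha:
  assumes "cmod l < 1"
  shows "Im (alpha l) = (1 - (cmod l)\<^sup>2) / (cmod (1 - l))\<^sup>2"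
proof -
  have "2 * \<i> * complex_of_real (Im (alpha l)) = alpha l - cnj (alpha l)"
    by (simp add: complex_eq_iff)
  also have "\<dots> = 2 * \<i> * of_real ((1 - (cmod l)\<^sup>2) / (cmod (1 - l))\<^sup>2)"
    unfolding alpha_plus_cnj_alpha[OF assms assms] of_real_divide of_real_diff complex_norm_square
    by simp
  finally show ?thesis by (metis mult_cancel_left of_real_eq_iff mult_eq_0_iff complex_i_not_zero zero_neq_numeral)
qed

lemma Im_alpha_pos: "cmod l < 1 \<Longrightarrow> 0 < Im (alpha l)"
  by (auto simp: Im_alpha abs_square_less_1 intro!: divide_pos_pos)

lemma alpha_vec_halfplane: "l \<in> polydisc \<Longrightarrow> alpha_vec l \<in> poly_halfplane"
  by (simp add: polydisc_def poly_halfplane_def alpha_vec_def Im_alpha_pos)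

lemma plus_i_nonzero: "0 \<le> Im w \<Longrightarrow> w + \<i> \<noteq> 0"
  by (auto simp: complex_eq_iff)

text \<open>The counterpart of the formula for \<open>alpha\<close>, in the opposite direction. Real
  values of \<open>w\<close> and \<open>u\<close> are included, since \<open>F\<close> may take
  them.\<close>

lemma one_minus_beta:
  assumes "0 \<le> Im w" "0 \<le> Im u"
  shows "1 - beta w * cnj (beta u) = - 2 * \<i> * (w - cnj u) / ((w + \<i>) * cnj (u + \<i>))"
proof -
  define p q where "p = w + \<i>" and "q = cnj (u + \<i>)"
  have nz: "p \<noteq> 0" "q \<noteq> 0"
    unfolding p_def q_def using assms plus_i_nonzero by (simp_all only: complex_cnj_zero_iff not_False_eq_True)
  have eqs: "beta w = (p - 2 * \<i>) / p" "cnj (beta u) = (q + 2 * \<i>) / q" "w - cnj u = p - q - 2 * \<i>"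
    by (simp_all add: beta_def p_def q_def)
  show ?thesis
    unfolding p_def[symmetric] q_def[symmetric] eqs using nz by (simp add: field_simps)
qed

lemma one_minus_norm_beta:
  assumes "0 \<le> Im w"
  shows "1 - (cmod (beta w))\<^sup>2 = 4 * Im w / (cmod (w + \<i>))\<^sup>2"
proof -
  have "complex_of_real (1 - (cmod (beta w))\<^sup>2) = 1 - beta w * cnj (beta w)"
    by (simp only: of_real_diff of_real_1 complex_norm_square)
  also have "\<dots> = - 2 * \<i> * (w - cnj w) / ((w + \<i>) * cnj (w + \<i>))" by (rule one_minus_beta[OF assms assms])
  also have "\<dots> = of_real (4 * Im w / (cmod (w + \<i>))\<^sup>2)"
  proof -
    have "- 2 * \<i> * (w - cnj w) = of_real (4 * Im w)" by (simp add: complex_eq_iff)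
    then show ?thesis by (simp only: of_real_divide complex_norm_square)
  qed
  finally show ?thesis by (metis of_real_eq_iff)
qed

lemma norm_beta_le: "0 \<le> Im w \<Longrightarrow> cmod (beta w) \<le> 1"
  using one_minus_norm_beta[of w] abs_square_le_1[of "cmod (beta w)"] zero_le_divide_iff
  by (smt (verit) norm_ge_zero zero_le_power2)

lemma norm_beta_diff_le:
  assumes "0 \<le> Im w" "0 \<le> Im u"
  shows "cmod (beta w - beta u) \<le> 2 * cmod (w - u)"
proof -
  have nz: "w + \<i> \<noteq> 0" "u + \<i> \<noteq> 0" using assms by (simp_all add: plus_i_nonzero)
  have ge: "1 \<le> cmod (w + \<i>)" "1 \<le> cmod (u + \<i>)"
    using assms abs_Im_le_cmod[of "w + \<i>"] abs_Im_le_cmod[of "u + \<i>"] by simp_all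
  have "beta w - beta u = 2 * \<i> * (w - u) / ((w + \<i>) * (u + \<i>))"
    using nz by (simp add: beta_def field_simps)
  then have "cmod (beta w - beta u) = 2 * cmod (w - u) / (cmod (w + \<i>) * cmod (u + \<i>))"
    by (simp add: norm_mult norm_divide)
  also have "\<dots> \<le> 2 * cmod (w - u) / 1"
    using ge mult_mono[OF ge] by (intro divide_left_mono) auto
  finally show ?thesis by simp
qed

text \<open>Under the Cayley transform the value 1 belongs to the point at infinity.\<close>

lemma beta_of_real_neq_1: "beta (of_real C) \<noteq> 1"
proof -
  have "complex_of_real C + \<i> \<noteq> 0" by (rule plus_i_nonzero) simp
  then show ?thesis by (simp add: beta_def)
qed

section \<open>The imaginary diagonal and the derivatives of the Cayley transforms\<close>

lemma vec_imaginary_halfplane: "0 < y \<Longrightarrow> (vec (\<i> * of_real y) :: complex ^ 'd) \<in> poly_halfplane"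
  by (simp add: poly_halfplane_def)

text \<open>\<open>(y - 1) / (y + 1)\<close> is \<open>beta (\<i> * y)\<close>: going up the
  imaginary diagonal is radial approach to the point 1 of the torus.\<close>

lemma alpha_vec_diagonal:
  assumes "0 < y"
  shows "alpha_vec (vec (of_real ((y - 1) / (y + 1)))) = vec (\<i> * of_real y)"
proof -
  have eqs: "1 + (y - 1) / (y + 1) = 2 * y / (y + 1)" "1 - (y - 1) / (y + 1) = 2 / (y + 1)"
    using assms by (simp_all add: field_simps)
  have "alpha (of_real ((y - 1) / (y + 1)))
      = \<i> * of_real ((1 + (y - 1) / (y + 1)) / (1 - (y - 1) / (y + 1)))"
    by (simp add: alpha_def)
  also have "(1 + (y - 1) / (y + 1)) / (1 - (y - 1) / (y + 1)) = y"
    unfolding eqs using assms by simp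
  finally have "alpha (of_real ((y - 1) / (y + 1))) = \<i> * of_real y" .
  then show ?thesis by (simp add: alpha_vec_def vec_eq_iff)
qed

lemma alpha_vec_has_derivative:
  assumes l: "l \<in> polydisc"
  shows "(alpha_vec has_derivative (\<lambda>h. \<chi> r. 2 * \<i> / (1 - l $ r)\<^sup>2 * h $ r)) (at l)"
proof -
  \<comment> \<open>Writing a vector as a sum of axis vectors reduces the derivative to the
    coordinates.\<close>
  have expand: "vec_lambda f = (\<Sum>r\<in>UNIV. axis r (f r))" for f :: "'a \<Rightarrow> complex"
    by (simp add: vec_eq_iff axis_def sum.delta')
  have axis: "bounded_linear (axis r :: complex \<Rightarrow> complex ^ 'a)" for r
    unfolding linear_conv_bounded_linear[symmetric]
    by (rule linearI) (simp_all add: vec_eq_iff axis_def)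
  have "(alpha has_field_derivative 2 * \<i> / (1 - w)\<^sup>2) (at w)" if "w \<noteq> 1" for w
    unfolding alpha_def[abs_def] using that
    by (auto intro!: derivative_eq_intros simp: field_simps power2_eq_square)
  moreover have "l $ r \<noteq> 1" for r using l by (auto simp: polydisc_def dest: spec[of _ r])
  ultimately have "(alpha has_derivative (\<lambda>x. 2 * \<i> / (1 - l $ r)\<^sup>2 * x)) (at (l $ r))" for r
    unfolding has_field_derivative_def by blast
  then have "((\<lambda>l. axis r (alpha (l $ r))) has_derivative (\<lambda>h. axis r (2 * \<i> / (1 - l $ r)\<^sup>2 * h $ r))) (at l)" for r
    by (intro bounded_linear.has_derivative[OF axis]
        has_derivative_compose[OF bounded_linear_imp_has_derivative[OF bounded_linear_vec_nth]])
  then show ?thesis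
    unfolding alpha_vec_def[abs_def] expand by (intro has_derivative_sum)
qed

lemma beta_has_derivative:
  assumes "0 \<le> Im w"
  shows "(beta has_derivative (\<lambda>h. 2 * \<i> / (w + \<i>)\<^sup>2 * h)) (at w)"
proof -
  have "(beta has_field_derivative 2 * \<i> / (w + \<i>)\<^sup>2) (at w)"
    unfolding beta_def[abs_def] using plus_i_nonzero[OF assms]
    by (auto intro!: derivative_eq_intros simp: field_simps power2_eq_square)
  then show ?thesis unfolding has_field_derivative_def .
qed

section \<open>Julia's inequality on the polydisc\<close>

lemma norm_nth_le_max_norm: "cmod (l $ r) \<le> max_norm (l :: complex ^ 'd)"
  unfolding max_norm_def by (intro Max_ge) auto

lemma max_norm_le_iff: "max_norm (l :: complex ^ 'd) \<le> a \<longleftrightarrow> (\<forall>r. cmod (l $ r) \<le> a)"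
  unfolding max_norm_def by (subst Max_le_iff) auto

lemma max_norm_less_iff: "max_norm (l :: complex ^ 'd) < a \<longleftrightarrow> (\<forall>r. cmod (l $ r) < a)"
  unfolding max_norm_def by (subst Max_less_iff) auto

lemma max_norm_le_norm: "max_norm (l :: complex ^ 'd) \<le> norm l"
  by (simp add: max_norm_le_iff Finite_Cartesian_Product.norm_nth_le)

lemma max_norm_nonneg: "0 \<le> max_norm (l :: complex ^ 'd)"
  using norm_nth_le_max_norm norm_ge_zero order_trans by blast

lemma max_norm_vec: "max_norm (vec a :: complex ^ 'd) = cmod a"
  by (simp add: max_norm_def)

lemma one_minus_square_bounds:
  fixes x :: real
  assumes "0 \<le> x" "x \<le> 1"
  shows "1 - x \<le> 1 - x\<^sup>2" "1 - x\<^sup>2 \<le> 2 * (1 - x)"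
proof -
  show "1 - x \<le> 1 - x\<^sup>2" using assms mult_left_le[of x x] by (simp add: power2_eq_square)
  show "1 - x\<^sup>2 \<le> 2 * (1 - x)" using zero_le_power2[of "1 - x"] by (simp add: power2_eq_square algebra_simps)
qed

text \<open>The strict inequality on \<open>l\<close> survives replacing \<open>1\<close> by a nearby point of the sequence that
  witnesses the \<open>B\<close>-point.\<close>

lemma julia:
  fixes \<phi> :: "complex ^ 'd \<Rightarrow> complex"
  assumes le_1: "\<And>l. l \<in> polydisc \<Longrightarrow> cmod (\<phi> l) \<le> 1"
    and schwarz_pick: "\<And>l m B. l \<in> polydisc \<Longrightarrow> m \<in> polydisc \<Longrightarrow>
      (\<And>r. (cmod (1 - l $ r * cnj (m $ r)))\<^sup>2 \<le> B * ((1 - (cmod (l $ r))\<^sup>2) * (1 - (cmod (m $ r))\<^sup>2))) \<Longrightarrow>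
      (cmod (1 - \<phi> l * cnj (\<phi> m)))\<^sup>2 \<le> B * ((1 - (cmod (\<phi> l))\<^sup>2) * (1 - (cmod (\<phi> m))\<^sup>2))"
    and B_point: "B_point \<phi> (vec 1)"
  obtains \<omega> K where "cmod \<omega> = 1" "0 \<le> K"
    "\<And>l Q. l \<in> polydisc \<Longrightarrow> (\<And>r. (cmod (1 - l $ r))\<^sup>2 < Q * (1 - (cmod (l $ r))\<^sup>2)) \<Longrightarrow>
      cmod (\<phi> l - \<omega>) \<le> K * Q"
proof -
  obtain m' where m': "\<And>n. m' n \<in> polydisc" "m' \<longlonglongrightarrow> vec 1"
    "bounded (range (\<lambda>n. (1 - cmod (\<phi> (m' n))) / (1 - max_norm (m' n))))"
    using B_point unfolding B_point_def by blast
  have pos': "0 < 1 - max_norm (m' n)" for n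
    using m'(1)[of n] by (simp add: polydisc_def max_norm_less_iff)
  obtain K where K: "\<And>n. \<bar>(1 - cmod (\<phi> (m' n))) / (1 - max_norm (m' n))\<bar> \<le> K"
    using m'(3) unfolding bounded_iff by auto
  then have K0: "0 \<le> K" using abs_ge_zero order_trans by blast
  have quot': "1 - cmod (\<phi> (m' n)) \<le> K * (1 - max_norm (m' n))" for n
    using K[of n] pos'[of n] by (simp add: abs_le_iff divide_le_eq)
  \<comment> \<open>The candidate \<omega> for the boundary value is a cluster point of the values
    along the witnessing sequence.\<close>
  have "seq_compact (cball (0::complex) 1)" by (intro compact_imp_seq_compact) simp
  then obtain \<omega> s where s: "strict_mono (s :: nat \<Rightarrow> nat)" and lim: "((\<lambda>n. \<phi> (m' n)) \<circ> s) \<longlonglongrightarrow> \<omega>"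
    using le_1[OF m'(1)] by (auto elim!: seq_compactE[of _ "\<lambda>n. \<phi> (m' n)"])
  define m where "m = m' \<circ> s"
  have m: "\<And>n. m n \<in> polydisc" "m \<longlonglongrightarrow> vec 1" "(\<lambda>n. \<phi> (m n)) \<longlonglongrightarrow> \<omega>"
      "\<And>n. 0 < 1 - max_norm (m n)" "\<And>n. 1 - cmod (\<phi> (m n)) \<le> K * (1 - max_norm (m n))"
    using m'(1) LIMSEQ_subseq_LIMSEQ[OF m'(2) s] lim pos' quot' by (simp_all add: m_def o_def)
  have nth: "(\<lambda>n. m n $ r) \<longlonglongrightarrow> 1" for r
    using tendsto_vec_nth[OF m(2), of r] by simp
  have norm_\<omega>: "cmod \<omega> = 1"
  proof (rule antisym)
    show "cmod \<omega> \<le> 1"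
      using le_1[OF m(1)] by (intro tendsto_upperbound[OF tendsto_norm[OF m(3)]]) auto
    \<comment> \<open>In the limit the bounded quotient leaves no room: any single coordinate of
      \<open>m n\<close> tends to 1, so the right-hand side tends to 0.\<close>
    have "1 - cmod \<omega> \<le> K * (1 - cmod 1)"
    proof (rule tendsto_le[OF sequentially_bot])
      show "(\<lambda>n. 1 - cmod (\<phi> (m n))) \<longlonglongrightarrow> 1 - cmod \<omega>" by (intro tendsto_intros m)
      show "(\<lambda>n. K * (1 - cmod (m n $ r))) \<longlonglongrightarrow> K * (1 - cmod 1)" for r by (intro tendsto_intros nth)
      have "1 - cmod (\<phi> (m n)) \<le> K * (1 - cmod (m n $ r))" for n r
        using m(5)[of n] mult_left_mono[OF _ K0, of "1 - max_norm (m n)" "1 - cmod (m n $ r)"]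
          norm_nth_le_max_norm[of "m n" r] by linarith
      then show "\<forall>\<^sub>F n in sequentially. 1 - cmod (\<phi> (m n)) \<le> K * (1 - cmod (m n $ r))" for r by simp
    qed
    then show "1 \<le> cmod \<omega>" by simp
  qed
  have "cmod (\<phi> l - \<omega>) \<le> (4 * K) * Q"
    if l: "l \<in> polydisc" and Q: "\<And>r. (cmod (1 - l $ r))\<^sup>2 < Q * (1 - (cmod (l $ r))\<^sup>2)" for l Q
  proof -
    have pos: "0 < 1 - (cmod (l $ r))\<^sup>2" for r
      using l by (simp add: polydisc_def abs_square_less_1)
    have Q0: "0 < Q" using Q pos by (metis zero_le_power2 le_less_trans zero_less_mult_pos2)
    have "\<forall>\<^sub>F n in sequentially. (cmod (1 - l $ r * cnj (m n $ r)))\<^sup>2 < Q * (1 - (cmod (l $ r))\<^sup>2)" for r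
    proof (rule order_tendstoD(2)[OF _ Q])
      have "(\<lambda>n. (cmod (1 - l $ r * cnj (m n $ r)))\<^sup>2) \<longlonglongrightarrow> (cmod (1 - l $ r * cnj 1))\<^sup>2"
        by (intro tendsto_intros nth)
      then show "(\<lambda>n. (cmod (1 - l $ r * cnj (m n $ r)))\<^sup>2) \<longlonglongrightarrow> (cmod (1 - l $ r))\<^sup>2" by simp
    qed
    then have ev: "\<forall>\<^sub>F n in sequentially. \<forall>r. (cmod (1 - l $ r * cnj (m n $ r)))\<^sup>2 < Q * (1 - (cmod (l $ r))\<^sup>2)"
      by (rule eventually_all_finite)
    have "\<forall>\<^sub>F n in sequentially. (cmod (1 - \<phi> l * cnj (\<phi> (m n))))\<^sup>2 \<le> 2 * K * Q * (1 - (cmod (\<phi> l))\<^sup>2)"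
      using ev
    proof eventually_elim
      case (elim n)
      \<comment> \<open>Schwarz-Pick is applied with the large constant \<open>Q / a\<close>; the
        factor \<open>a\<close> cancels against the bound \<open>2 * K * a\<close> for the defect of
        \<phi> at \<open>m n\<close>.\<close>
      define a where "a = 1 - max_norm (m n)"
      have a: "0 < a" using m(4) by (simp add: a_def)
      have "(cmod (1 - \<phi> l * cnj (\<phi> (m n))))\<^sup>2 \<le> Q / a * ((1 - (cmod (\<phi> l))\<^sup>2) * (1 - (cmod (\<phi> (m n)))\<^sup>2))"
      proof (rule schwarz_pick[OF l m(1)])
        fix r
        have "cmod (m n $ r) < 1" using m(1)[of n] by (simp add: polydisc_def)
        then have "a \<le> 1 - (cmod (m n $ r))\<^sup>2"
          using norm_nth_le_max_norm[of "m n" r] one_minus_square_bounds(1)[of "cmod (m n $ r)"]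
          by (simp add: a_def)
        then have "Q / a * ((1 - (cmod (l $ r))\<^sup>2) * a) \<le> Q / a * ((1 - (cmod (l $ r))\<^sup>2) * (1 - (cmod (m n $ r))\<^sup>2))"
          using Q0 a pos[of r] by (intro mult_left_mono) auto
        then show "(cmod (1 - l $ r * cnj (m n $ r)))\<^sup>2 \<le> Q / a * ((1 - (cmod (l $ r))\<^sup>2) * (1 - (cmod (m n $ r))\<^sup>2))"
          using elim[rule_format, of r] a by simp
      qed
      also have "\<dots> \<le> Q / a * ((1 - (cmod (\<phi> l))\<^sup>2) * (2 * K * a))"
      proof (intro mult_left_mono)
        show "1 - (cmod (\<phi> (m n)))\<^sup>2 \<le> 2 * K * a"
          using one_minus_square_bounds(2)[OF norm_ge_zero le_1[OF m(1)[of n]]] m(5)[of n] by (simp add: a_def)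
      qed (use le_1[OF l] Q0 a in \<open>auto simp: abs_square_le_1\<close>)
      finally show ?case using a by (simp add: mult_ac)
    qed
    moreover have "(\<lambda>n. (cmod (1 - \<phi> l * cnj (\<phi> (m n))))\<^sup>2) \<longlonglongrightarrow> (cmod (1 - \<phi> l * cnj \<omega>))\<^sup>2"
      by (intro tendsto_intros m)
    ultimately have "(cmod (1 - \<phi> l * cnj \<omega>))\<^sup>2 \<le> 2 * K * Q * (1 - (cmod (\<phi> l))\<^sup>2)"
      by (intro tendsto_upperbound) auto
    moreover have "cmod (1 - \<phi> l * cnj \<omega>) = cmod (\<phi> l - \<omega>)"
    proof -
      have "1 - \<phi> l * cnj \<omega> = (\<omega> - \<phi> l) * cnj \<omega>"
        using complex_norm_square[of \<omega>] norm_\<omega> by (simp add: algebra_simps)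
      then show ?thesis by (simp add: norm_mult norm_\<omega> norm_minus_commute)
    qed
    \<comment> \<open>As \<omega> is unimodular, the defect of \<phi> at \<open>l\<close> is itself
      controlled by the distance to \<omega>. Cancelling one factor then turns the quadratic
      estimate into a linear one.\<close>
    moreover have "1 - (cmod (\<phi> l))\<^sup>2 \<le> 2 * cmod (\<phi> l - \<omega>)"
      using one_minus_square_bounds(2)[OF norm_ge_zero le_1[OF l]] norm_triangle_ineq2[of \<omega> "\<phi> l"] norm_\<omega>
      by (simp add: norm_minus_commute)
    ultimately have "(cmod (\<phi> l - \<omega>))\<^sup>2 \<le> 2 * K * Q * (2 * cmod (\<phi> l - \<omega>))"
      using K0 Q0 mult_left_mono[of "1 - (cmod (\<phi> l))\<^sup>2" "2 * cmod (\<phi> l - \<omega>)" "2 * K * Q"] by simp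
    then have "cmod (\<phi> l - \<omega>) * cmod (\<phi> l - \<omega>) \<le> (4 * K * Q) * cmod (\<phi> l - \<omega>)"
      by (simp add: power2_eq_square mult_ac)
    then show ?thesis
      using K0 Q0 by (cases "cmod (\<phi> l - \<omega>) = 0") (simp_all add: mult_le_cancel_right)
  qed
  then show thesis using that[OF norm_\<omega>, of "4 * K"] K0 by simp
qed

section \<open>Nontangential approach to the point 1 of the torus\<close>

lemma approach_region_bound:
  fixes l :: "complex ^ 'd"
  assumes l: "l \<in> approach_region (vec 1) a" and r: "r = max_norm (l - vec 1)"
  shows "l \<in> polydisc" "0 < r" "0 < a" "(cmod (1 - l $ k))\<^sup>2 < 2 * a * r * (1 - (cmod (l $ k))\<^sup>2)"
proof -
  show pd: "l \<in> polydisc" using l by (simp add: approach_region_def)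
  have lt: "cmod (l $ j) < 1" for j using pd by (simp add: polydisc_def)
  have near: "cmod (1 - l $ j) \<le> r" for j
    using norm_nth_le_max_norm[of "l - vec 1" j] by (simp add: r norm_minus_commute)
  have "l $ k \<noteq> 1" using lt[of k] by auto
  then have "0 < cmod (1 - l $ k)" by simp
  then show r0: "0 < r" using near[of k] by linarith
  have le: "r \<le> a * (1 - max_norm l)" using l by (simp add: approach_region_def r)
  have mx: "0 < 1 - max_norm l" using lt by (simp add: max_norm_less_iff)
  show a: "0 < a" using le r0 mx by (metis less_le_trans zero_less_mult_pos2)
  have "1 - max_norm l \<le> 1 - (cmod (l $ k))\<^sup>2"
    using norm_nth_le_max_norm[of l k] one_minus_square_bounds(1)[of "cmod (l $ k)"] lt[of k] by simp
  then have "r \<le> a * (1 - (cmod (l $ k))\<^sup>2)"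
    using le a by (meson mult_left_mono less_imp_le order_trans)
  then have "r * r \<le> r * (a * (1 - (cmod (l $ k))\<^sup>2))" using r0 by simp
  moreover have "(cmod (1 - l $ k))\<^sup>2 \<le> r * r"
    using power_mono[OF near[of k] norm_ge_zero, of 2] by (simp add: power2_eq_square)
  \<comment> \<open>Positivity together with the factor 2 gives the strict inequality that Julia's
    inequality asks for.\<close>
  moreover have "0 < r * r" using r0 by simp
  ultimately have "(cmod (1 - l $ k))\<^sup>2 < 2 * (r * (a * (1 - (cmod (l $ k))\<^sup>2)))" by linarith
  then show "(cmod (1 - l $ k))\<^sup>2 < 2 * a * r * (1 - (cmod (l $ k))\<^sup>2)" by (simp only: mult_ac)
qed

lemma vec_in_approach_region:
  assumes "0 \<le> s" "s < 1"
  shows "vec (complex_of_real s) \<in> approach_region (vec 1 :: complex ^ 'd) 1"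
proof -
  have "(vec (complex_of_real s) - vec 1 :: complex ^ 'd) = vec (of_real (s - 1))"
    by (simp add: vec_eq_iff)
  then show ?thesis using assms by (simp only: approach_region_def max_norm_vec)
      (simp add: polydisc_def max_norm_vec del: of_real_diff)
qed

text \<open>Convergence along a supremum of filters is convergence along each of them, and for a
  fixed aperture the bound tends to 0.\<close>

lemma tendsto_nontangentialI:
  fixes f :: "complex ^ 'd \<Rightarrow> complex"
  assumes "\<And>a l. l \<in> approach_region (vec 1) a \<Longrightarrow> cmod (f l - w) \<le> K * (a * max_norm (l - vec 1))"
  shows "(f \<longlongrightarrow> w) (nontangential (vec 1))"
proof -
  have "(f \<longlongrightarrow> w) (at (vec 1) within approach_region (vec 1) a)" for a
  proof (rule LIM_zero_cancel, rule Lim_null_comparison)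
    have "((\<lambda>l :: complex ^ 'd. \<bar>K * a\<bar> * norm (l - vec 1)) \<longlongrightarrow> \<bar>K * a\<bar> * norm (vec 1 - vec 1 :: complex ^ 'd))
        (at (vec 1) within approach_region (vec 1) a)"
      by (intro tendsto_intros)
    then show "((\<lambda>l :: complex ^ 'd. \<bar>K * a\<bar> * norm (l - vec 1)) \<longlongrightarrow> 0)
        (at (vec 1) within approach_region (vec 1) a)" by simp
    have "cmod (f l - w) \<le> \<bar>K * a\<bar> * norm (l - vec 1)" if "l \<in> approach_region (vec 1) a" for l
    proof -
      have "K * a * max_norm (l - vec 1) \<le> \<bar>K * a\<bar> * norm (l - vec 1)"
        by (intro mult_mono max_norm_le_norm max_norm_nonneg) auto
      then show ?thesis using assms[OF that] by (simp add: mult.assoc)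
    qed
    then show "\<forall>\<^sub>F l in at (vec 1) within approach_region (vec 1) a.
        cmod (f l - w) \<le> \<bar>K * a\<bar> * norm (l - vec 1)"
      by (auto simp: eventually_at_filter)
  qed
  then show ?thesis
    unfolding nontangential_def filterlim_def filtermap_SUP by (simp add: SUP_le_iff)
qed

text \<open>\<open>Lim\<close> is determined by convergence only along a nontrivial filter. Radial
  points accumulate at 1 already inside the region of aperture 1.\<close>

lemma nontangential_nontrivial: "nontangential (vec 1 :: complex ^ 'd) \<noteq> bot"
proof
  let ?S = "approach_region (vec 1 :: complex ^ 'd) 1"
  assume "nontangential (vec 1 :: complex ^ 'd) = bot"
  moreover have "at (vec 1) within ?S \<le> nontangential (vec 1)"
    unfolding nontangential_def by (rule SUP_upper) simp
  ultimately have "trivial_limit (at (vec 1) within ?S)" by (simp add: le_bot)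
  moreover have "vec 1 islimpt ?S"
    unfolding islimpt_sequential
  proof (intro exI[of _ "\<lambda>n. vec (of_real (1 - 1 / real (Suc n)))"] conjI allI)
    show "vec (of_real (1 - 1 / real (Suc n))) \<in> ?S - {vec 1}" for n
    proof -
      have "complex_of_real (1 - 1 / real (Suc n)) \<noteq> 1" by (simp only: of_real_eq_1_iff) simp
      then have "vec (of_real (1 - 1 / real (Suc n))) \<noteq> (vec 1 :: complex ^ 'd)"
        unfolding vec_eq_iff vec_component by blast
      then show ?thesis using vec_in_approach_region[of "1 - 1 / real (Suc n)"] by simp
    qed
    have "(\<lambda>n. complex_of_real (1 - 1 / real (Suc n))) \<longlonglongrightarrow> of_real (1 - 0)"
      by (intro tendsto_intros LIMSEQ_Suc[OF lim_1_over_n])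
    then show "(\<lambda>n. vec (of_real (1 - 1 / real (Suc n)))) \<longlonglongrightarrow> (vec 1 :: complex ^ 'd)"
      by (intro vec_tendstoI) simp
  qed
  ultimately show False by (simp add: trivial_limit_within)
qed

section \<open>The representation and its Cayley transform\<close>

text \<open>The limit inferior is infinite exactly when \<open>f\<close> eventually exceeds every
  real bound. The frequent bound is the form in which conditions (i) and (iv) are used
  below.\<close>

lemma Liminf_ereal_less_infinity_iff:
  "Liminf F (\<lambda>y. ereal (f y)) < \<infinity> \<longleftrightarrow> (\<exists>K. \<exists>\<^sub>F y in F. f y \<le> K)"
proof
  assume *: "Liminf F (\<lambda>y. ereal (f y)) < \<infinity>"
  show "\<exists>K. \<exists>\<^sub>F y in F. f y \<le> K"
  proof (rule ccontr)
    assume "\<nexists>K. \<exists>\<^sub>F y in F. f y \<le> K"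
    then have ev: "\<forall>\<^sub>F y in F. K < f y" for K by (simp add: not_frequently not_le)
    have "\<infinity> \<le> Liminf F (\<lambda>y. ereal (f y))"
      unfolding le_Liminf_iff
    proof (intro allI impI)
      fix u :: ereal assume "u < \<infinity>"
      then show "\<forall>\<^sub>F y in F. u < ereal (f y)"
        using ev by (cases u) simp_all
    qed
    with * show False by simp
  qed
next
  assume "\<exists>K. \<exists>\<^sub>F y in F. f y \<le> K"
  then obtain K where K: "\<exists>\<^sub>F y in F. f y \<le> K" ..
  show "Liminf F (\<lambda>y. ereal (f y)) < \<infinity>"
  proof (rule ccontr)
    assume "\<not> Liminf F (\<lambda>y. ereal (f y)) < \<infinity>"
    then have "\<infinity> \<le> Liminf F (\<lambda>y. ereal (f y))" by simp
    then have "\<forall>\<^sub>F y in F. ereal K < ereal (f y)" unfolding le_Liminf_iff by (elim allE[of _ "ereal K"]) simp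
    then have "\<forall>\<^sub>F y in F. \<not> f y \<le> K" by (simp add: not_le)
    with K show False by (simp add: frequently_def)
  qed
qed

section \<open>The representation of \<open>F\<close> and the vectors \<open>v_at z\<close>\<close>

locale loewner_representation = self_adjoint_operator M D X
  for M :: "'d::finite \<Rightarrow> 'h::complex_hilbert set" and D X +
  fixes F :: "complex ^ 'd \<Rightarrow> complex" and c :: real and z\<^sub>0 :: "complex ^ 'd" and v :: 'h
    and v_at :: "complex ^ 'd \<Rightarrow> 'h"
  assumes representation: "z \<in> poly_halfplane \<Longrightarrow>
      F z = of_real c + cinner (pt z v) v + cinner (pt (z - cnj_vec z\<^sub>0) (R z (pt (z - z\<^sub>0) v))) v"
    and v_at: "z \<in> poly_halfplane \<Longrightarrow> v_at z = v + R z (pt (z - z\<^sub>0) v)"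
begin

abbreviation iy :: "real \<Rightarrow> complex ^ 'd" where "iy y \<equiv> vec (\<i> * of_real y)"

text \<open>The difference \<open>v_at z - v\<close> is a value of the resolvent, so
  \<open>X\<close> may be applied to it even when \<open>v\<close> itself lies outside
  \<open>D\<close>.\<close>

lemma
  assumes z: "z \<in> poly_halfplane"
  shows v_at_minus_dom: "v_at z - v \<in> D"
    and op_v_at: "X (v_at z - v) = pt z (v_at z) - pt z\<^sub>0 v"
  using z by (simp_all add: v_at resolvent_dom op_resolvent point_op.add_right point_op.diff_left)

text \<open>The term with \<open>z - z\<^sub>0\<^sup>*\<close> applied to \<open>v\<close> is
  absorbed into the one with \<open>v_at z\<close>; of the linear term only
  \<open>z\<^sub>0\<^sup>*\<close> is left.\<close>

lemma F_v_at:
  assumes z: "z \<in> poly_halfplane"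
  shows "F z = of_real c + cinner (pt (cnj_vec z\<^sub>0) v) v + cinner (pt (z - cnj_vec z\<^sub>0) (v_at z)) v"
  using z by (simp add: representation v_at point_op.add_right point_op.diff_left cinner.add_left
      cinner.diff_left)

text \<open>Symmetry of \<open>X\<close> between \<open>v_at z - v\<close> and
  \<open>v_at w - v\<close>, with the values of \<open>X\<close> inserted. This is the kernel
  identity of the Loewner class, with the inner products of the components of \<open>v_at z\<close>
  and \<open>v_at w\<close> as kernels.\<close>

lemma F_minus_cnj_F:
  assumes z: "z \<in> poly_halfplane" and w: "w \<in> poly_halfplane"
  shows "F z - cnj (F w) = cinner (pt (z - cnj_vec w) (v_at z)) (v_at w)"
proof -
  have cc: "cnj_vec (cnj_vec u) = u" "cnj_vec (u - u') = cnj_vec u - cnj_vec u'" for u u' :: "complex ^ 'd"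
    by (simp_all add: cnj_vec_def vec_eq_iff)
  have "cinner (X (v_at z - v)) (v_at w - v) = cinner (v_at z - v) (X (v_at w - v))"
    by (simp add: symmetric v_at_minus_dom z w)
  then have "cinner (pt z (v_at z)) (v_at w) - cinner (pt z (v_at z)) v
        - cinner (pt z\<^sub>0 v) (v_at w) + cinner (pt z\<^sub>0 v) v
      = cinner (pt (cnj_vec w) (v_at z)) (v_at w) - cinner (pt (cnj_vec w) v) (v_at w)
        - cinner (pt (cnj_vec z\<^sub>0) (v_at z)) v + cinner (pt (cnj_vec z\<^sub>0) v) v"
    by (simp add: op_v_at z w cinner.diff_left cinner.diff_right cinner_point_op_adjoint[of "cnj_vec _"] cc
        algebra_simps)
  then show ?thesis
    by (simp add: F_v_at z w cnj_cinner_point_op cc point_op.diff_left cinner.diff_left algebra_simps)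
qed

lemma Im_F:
  assumes z: "z \<in> poly_halfplane"
  shows "Im (F z) = (\<Sum>r\<in>UNIV. Im (z $ r) * (norm (comp (v_at z) r))\<^sup>2)"
proof -
  have "2 * \<i> * of_real (Im (F z)) = F z - cnj (F z)" by (simp add: complex_eq_iff)
  also have "\<dots> = (\<Sum>r\<in>UNIV. 2 * \<i> * of_real (Im (z $ r) * (norm (comp (v_at z) r))\<^sup>2))"
    unfolding F_minus_cnj_F[OF z z] cinner_point_op
    by (intro sum.cong refl) (simp add: cinner_self cnj_vec_def complex_eq_iff flip: of_real_power)
  also have "\<dots> = 2 * \<i> * of_real (\<Sum>r\<in>UNIV. Im (z $ r) * (norm (comp (v_at z) r))\<^sup>2)"
    by (simp add: sum_distrib_left)
  finally show ?thesis unfolding mult_cancel_left of_real_eq_iff by simp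
qed

lemma Im_F_nonneg: "z \<in> poly_halfplane \<Longrightarrow> 0 \<le> Im (F z)"
  by (simp add: Im_F sum_nonneg poly_halfplane_def less_imp_le)

lemma Im_F_diagonal: "0 < y \<Longrightarrow> Im (F (iy y)) = y * (norm (v_at (iy y)))\<^sup>2"
  by (simp add: Im_F vec_imaginary_halfplane norm_components[of "v_at _"] sum_distrib_left)

text \<open>Cauchy-Schwarz is applied to the kernel identity twice: in each component, then over the
  components. The weights \<open>sqrt (Im (z $ r))\<close> and \<open>sqrt (Im (w $ r))\<close> make
  the squares add up to \<open>Im (F z)\<close> and \<open>Im (F w)\<close>.\<close>

lemma schwarz_pick_halfplane:
  assumes z: "z \<in> poly_halfplane" and w: "w \<in> poly_halfplane"
    and B: "\<And>r. (cmod (z $ r - cnj (w $ r)))\<^sup>2 \<le> B * (Im (z $ r) * Im (w $ r))"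
  shows "(cmod (F z - cnj (F w)))\<^sup>2 \<le> B * (Im (F z) * Im (F w))"
proof -
  define a where "a r = sqrt (Im (z $ r)) * norm (comp (v_at z) r)" for r
  define b where "b r = sqrt (Im (w $ r)) * norm (comp (v_at w) r)" for r
  have pos: "0 < Im (z $ r)" "0 < Im (w $ r)" for r using z w by (simp_all add: poly_halfplane_def)
  have B0: "0 \<le> B"
  proof -
    fix r
    have "0 \<le> B * (Im (z $ r) * Im (w $ r))" by (rule order_trans[OF zero_le_power2 B])
    moreover have "0 < Im (z $ r) * Im (w $ r)" using pos by simp
    ultimately show "0 \<le> B" by (simp add: zero_le_mult_iff)
  qed
  have "cmod (F z - cnj (F w)) \<le> (\<Sum>r\<in>UNIV. cmod ((z - cnj_vec w) $ r * cinner (comp (v_at z) r) (comp (v_at w) r)))"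
    unfolding F_minus_cnj_F[OF z w] cinner_point_op by (rule norm_sum)
  also have "\<dots> \<le> (\<Sum>r\<in>UNIV. sqrt B * (a r * b r))"
  proof (rule sum_mono)
    fix r
    have "cmod (z $ r - cnj (w $ r)) \<le> sqrt B * (sqrt (Im (z $ r)) * sqrt (Im (w $ r)))"
      using real_le_rsqrt[OF B[of r]] by (simp add: real_sqrt_mult)
    then have "cmod (z $ r - cnj (w $ r)) * cmod (cinner (comp (v_at z) r) (comp (v_at w) r))
        \<le> sqrt B * (sqrt (Im (z $ r)) * sqrt (Im (w $ r))) * (norm (comp (v_at z) r) * norm (comp (v_at w) r))"
      using pos[of r] B0 by (intro mult_mono norm_cinner_le) auto
    then show "cmod ((z - cnj_vec w) $ r * cinner (comp (v_at z) r) (comp (v_at w) r)) \<le> sqrt B * (a r * b r)"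
      by (simp add: norm_mult cnj_vec_def a_def b_def mult_ac)
  qed
  finally have "(cmod (F z - cnj (F w)))\<^sup>2 \<le> (sqrt B * (\<Sum>r\<in>UNIV. a r * b r))\<^sup>2"
    by (intro power_mono) (simp_all add: sum_distrib_left)
  also have "\<dots> = B * (\<Sum>r\<in>UNIV. a r * b r)\<^sup>2" using B0 by (simp add: power_mult_distrib)
  also have "\<dots> \<le> B * ((\<Sum>r\<in>UNIV. (a r)\<^sup>2) * (\<Sum>r\<in>UNIV. (b r)\<^sup>2))"
    by (intro mult_left_mono Cauchy_Schwarz_ineq_sum B0)
  also have "\<dots> = B * (Im (F z) * Im (F w))"
    using pos by (simp add: Im_F z w a_def b_def power_mult_distrib less_imp_le)
  finally show ?thesis .
qed

section \<open>Membership of \<open>v\<close> in the domain of \<open>X\<close> and decay along the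
  diagonal\<close>

lemma representation_if_dom:
  assumes v: "v \<in> D"
  obtains v\<^sub>1 :: 'h and C :: real
  where "\<And>z. z \<in> poly_halfplane \<Longrightarrow> F z = of_real C + cinner (R z v\<^sub>1) v\<^sub>1"
proof
  fix z :: "complex ^ 'd" assume z: "z \<in> poly_halfplane"
  \<comment> \<open>With \<open>v\<close> in the domain, \<open>X - z\<close> maps
    \<open>v_at z\<close> to \<open>(X - z\<^sub>0) v\<close>, which does not depend on
    \<open>z\<close>.\<close>
  define v\<^sub>1 where "v\<^sub>1 = X v - pt z\<^sub>0 v"
  have dom: "v_at z \<in> D"
    using complex_vector.subspace_add[OF subspace_dom v_at_minus_dom[OF z] v] by simp
  have Xv: "X (v_at z) = pt z (v_at z) + v\<^sub>1"
    using op_diff[OF dom v] op_v_at[OF z] by (simp add: v\<^sub>1_def algebra_simps)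
  then have R: "R z v\<^sub>1 = v_at z" using resolvent_op[OF z dom] by simp
  have "cinner (v_at z) v\<^sub>1 = cinner (pt z (v_at z) + v\<^sub>1) v - cinner (pt (cnj_vec z\<^sub>0) (v_at z)) v"
    using symmetric[OF dom v] unfolding Xv[symmetric]
    by (simp add: v\<^sub>1_def cinner.diff_right cinner_point_op_adjoint[of "cnj_vec _"])
      (simp add: cnj_vec_def)
  \<comment> \<open>The terms free of \<open>z\<close> combine to a real constant: a number plus its
    conjugate, minus the real number \<open>cinner (X v) v\<close>.\<close>
  then have "F z = of_real c + (cinner (pt (cnj_vec z\<^sub>0) v) v + cinner (pt z\<^sub>0 v) v) - cinner (X v) v + cinner (v_at z) v\<^sub>1"
    by (simp add: F_v_at[OF z] v\<^sub>1_def point_op.diff_left cinner.diff_left cinner.add_left)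
  also have "cinner (pt (cnj_vec z\<^sub>0) v) v + cinner (pt z\<^sub>0 v) v = of_real (2 * Re (cinner (pt z\<^sub>0 v) v))"
    using cnj_cinner_point_op[of z\<^sub>0 v v] by (metis add.commute complex_add_cnj)
  also have "cinner (X v) v = of_real (Re (cinner (X v) v))"
    using Im_cinner_op[OF v] by (simp add: complex_eq_iff)
  finally show "F z = of_real (c + 2 * Re (cinner (pt z\<^sub>0 v) v) - Re (cinner (X v) v))
      + cinner (R z (X v - pt z\<^sub>0 v)) (X v - pt z\<^sub>0 v)"
    unfolding R[unfolded v\<^sub>1_def] by (simp add: v\<^sub>1_def)
qed

lemma dom_if_v_at_decay:
  assumes "\<exists>\<^sub>F y in at_top. y * norm (v_at (iy y)) \<le> K"
  shows "v \<in> D"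
proof (rule in_dom_if_functional_bounded)
  fix x assume x: "x \<in> D"
  show "cmod (cinner (X x) v) \<le> (K + norm (pt z\<^sub>0 v)) * norm x"
  proof (rule field_le_epsilon)
    fix e :: real assume e: "0 < e"
    \<comment> \<open>The lower bound on \<open>y\<close> is chosen so that
      \<open>norm (X x) * (K / y)\<close> is at most \<open>e\<close>; the 1 in it makes
      \<open>y\<close> positive.\<close>
    obtain y where y: "y * norm (v_at (iy y)) \<le> K" "max 1 (norm (X x) * K / e) \<le> y"
      using frequently_ex[OF frequently_eventually_frequently[OF assms eventually_ge_at_top]] by blast
    then have y0: "0 < y" by simp
    have z: "iy y \<in> poly_halfplane" by (rule vec_imaginary_halfplane[OF y0])
    have "cinner (X x) v = cinner (X x) (v_at (iy y)) - cinner (X x) (v_at (iy y) - v)"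
      by (simp add: cinner.diff_right)
    also have "cinner (X x) (v_at (iy y) - v) = cinner x ((\<i> * of_real y) *\<^sub>C v_at (iy y) - pt z\<^sub>0 v)"
      by (simp add: symmetric[OF x v_at_minus_dom[OF z]] op_v_at[OF z] point_op_vec)
    finally have "cmod (cinner (X x) v) \<le> cmod (cinner (X x) (v_at (iy y)))
        + cmod (cinner x ((\<i> * of_real y) *\<^sub>C v_at (iy y) - pt z\<^sub>0 v))"
      by (simp add: norm_triangle_ineq4)
    also have "\<dots> \<le> norm (X x) * norm (v_at (iy y)) + norm x * (K + norm (pt z\<^sub>0 v))"
    proof (intro add_mono norm_cinner_le order_trans[OF norm_cinner_le] mult_left_mono)
      show "norm ((\<i> * of_real y) *\<^sub>C v_at (iy y) - pt z\<^sub>0 v) \<le> K + norm (pt z\<^sub>0 v)"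
        using y y0 by (intro order_trans[OF norm_triangle_ineq4]) (simp add: norm_scaleC norm_mult)
    qed simp
    also have "norm (X x) * norm (v_at (iy y)) \<le> norm (X x) * (K / y)"
      using y y0 by (intro mult_left_mono) (simp_all add: field_simps)
    also have "norm (X x) * (K / y) \<le> e" using y y0 e by (simp add: field_simps)
    finally show "cmod (cinner (X x) v) \<le> (K + norm (pt z\<^sub>0 v)) * norm x + e" by (simp add: mult.commute)
  qed
qed

lemma v_at_decay_le:
  assumes y: "0 < y"
  shows "(y * norm (v_at (iy y)))\<^sup>2 \<le> y * cmod (F (iy y) - of_real C)"
proof -
  \<comment> \<open>Subtracting the real constant \<open>C\<close> leaves the imaginary part of
    \<open>F\<close> unchanged.\<close>
  have "(y * norm (v_at (iy y)))\<^sup>2 = y * Im (F (iy y) - of_real C)"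
    using Im_F_diagonal[OF y] by (simp add: power_mult_distrib power2_eq_square mult_ac)
  also have "\<dots> \<le> y * cmod (F (iy y) - of_real C)"
    using y abs_Im_le_cmod[of "F (iy y) - of_real C"] by (intro mult_left_mono) auto
  finally show ?thesis .
qed

lemma v_at_decay_if_F_decay:
  assumes "\<exists>\<^sub>F y in at_top. y * cmod (F (iy y) - of_real C) \<le> K"
  shows "\<exists>\<^sub>F y in at_top. y * norm (v_at (iy y)) \<le> sqrt K"
proof -
  have "\<exists>\<^sub>F y in at_top. y * cmod (F (iy y) - of_real C) \<le> K \<and> 0 < y"
    by (rule frequently_eventually_frequently[OF assms eventually_gt_at_top])
  then show ?thesis
  proof (rule frequently_elim1)
    fix y assume "y * cmod (F (iy y) - of_real C) \<le> K \<and> 0 < y"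
    then show "y * norm (v_at (iy y)) \<le> sqrt K"
      by (intro real_le_rsqrt order_trans[OF v_at_decay_le]) auto
  qed
qed

lemma F_decay_if_representation:
  assumes rep: "\<And>z. z \<in> poly_halfplane \<Longrightarrow> F z = of_real C + cinner (R z v\<^sub>1) v\<^sub>1"
    and "\<delta> > 0" "\<And>r. \<delta> \<le> Im (z $ r)"
  shows "cmod (F z - of_real C) \<le> (norm v\<^sub>1)\<^sup>2 / \<delta>"
proof -
  have "z \<in> poly_halfplane" using assms(2,3) by (auto simp: poly_halfplane_def intro: less_le_trans)
  then have "cmod (F z - of_real C) = cmod (cinner (R z v\<^sub>1) v\<^sub>1)" by (simp add: rep)
  also have "\<dots> \<le> norm v\<^sub>1 / \<delta> * norm v\<^sub>1"
    by (intro order_trans[OF norm_cinner_le] mult_right_mono norm_resolvent_le assms(2,3)) simp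
  finally show ?thesis by (simp add: power2_eq_square)
qed

section \<open>The Cayley transform of \<open>F\<close> on the polydisc\<close>

abbreviation \<phi> :: "complex ^ 'd \<Rightarrow> complex" where "\<phi> \<equiv> beta \<circ> F \<circ> alpha_vec"

lemma Im_F_alpha_nonneg: "l \<in> polydisc \<Longrightarrow> 0 \<le> Im (F (alpha_vec l))"
  by (simp add: Im_F_nonneg alpha_vec_halfplane)

lemma norm_\<phi>_le: "l \<in> polydisc \<Longrightarrow> cmod (\<phi> l) \<le> 1"
  by (simp add: norm_beta_le Im_F_alpha_nonneg)

lemma schwarz_pick_polydisc:
  assumes l: "l \<in> polydisc" and m: "m \<in> polydisc"
    and B: "\<And>r. (cmod (1 - l $ r * cnj (m $ r)))\<^sup>2 \<le> B * ((1 - (cmod (l $ r))\<^sup>2) * (1 - (cmod (m $ r))\<^sup>2))"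
  shows "(cmod (1 - \<phi> l * cnj (\<phi> m)))\<^sup>2 \<le> B * ((1 - (cmod (\<phi> l))\<^sup>2) * (1 - (cmod (\<phi> m))\<^sup>2))"
proof -
  let ?z = "alpha_vec l" and ?w = "alpha_vec m"
  define s where "s = (cmod (F ?z + \<i>))\<^sup>2 * (cmod (F ?w + \<i>))\<^sup>2"
  have s: "s \<ge> 0" by (simp add: s_def)
  \<comment> \<open>The factor 4 is the square of \<open>cmod (2 * \<i>)\<close> from the transform
    of the variables; transforming the values removes it again.\<close>
  have "(cmod (F ?z - cnj (F ?w)))\<^sup>2 \<le> (4 * B) * (Im (F ?z) * Im (F ?w))"
  proof (rule schwarz_pick_halfplane[OF alpha_vec_halfplane[OF l] alpha_vec_halfplane[OF m]])
    fix r
    have lm: "cmod (l $ r) < 1" "cmod (m $ r) < 1" using l m by (simp_all add: polydisc_def)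
    define t where "t = (cmod (1 - l $ r))\<^sup>2 * (cmod (1 - m $ r))\<^sup>2"
    have "cmod (1 - cnj (m $ r)) = cmod (1 - m $ r)"
      using complex_mod_cnj[of "1 - m $ r"] by simp
    then have "(cmod (?z $ r - cnj (?w $ r)))\<^sup>2 = 4 * (cmod (1 - l $ r * cnj (m $ r)))\<^sup>2 / t"
      using alpha_plus_cnj_alpha[OF lm]
      by (simp add: alpha_vec_def t_def norm_mult norm_divide power_mult_distrib power_divide)
    also have "\<dots> \<le> 4 * (B * ((1 - (cmod (l $ r))\<^sup>2) * (1 - (cmod (m $ r))\<^sup>2))) / t"
      by (intro divide_right_mono mult_left_mono B) (simp_all add: t_def)
    also have "\<dots> = 4 * B * (Im (?z $ r) * Im (?w $ r))"
      by (simp add: alpha_vec_def Im_alpha lm t_def)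
    finally show "(cmod (?z $ r - cnj (?w $ r)))\<^sup>2 \<le> 4 * B * (Im (?z $ r) * Im (?w $ r))" .
  qed
  then have "4 * (cmod (F ?z - cnj (F ?w)))\<^sup>2 / s \<le> 4 * (4 * B * (Im (F ?z) * Im (F ?w))) / s"
    using s by (intro divide_right_mono mult_left_mono) auto
  moreover have "cmod (cnj (F ?w) - \<i>) = cmod (F ?w + \<i>)"
    using complex_mod_cnj[of "F ?w + \<i>"] by simp
  then have "(cmod (1 - \<phi> l * cnj (\<phi> m)))\<^sup>2 = 4 * (cmod (F ?z - cnj (F ?w)))\<^sup>2 / s"
    using one_minus_beta[OF Im_F_alpha_nonneg[OF l] Im_F_alpha_nonneg[OF m]]
    by (simp add: s_def norm_mult norm_divide power_mult_distrib power_divide)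
  moreover have "B * ((1 - (cmod (\<phi> l))\<^sup>2) * (1 - (cmod (\<phi> m))\<^sup>2)) = 4 * (4 * B * (Im (F ?z) * Im (F ?w))) / s"
    using one_minus_norm_beta[OF Im_F_alpha_nonneg[OF l]] one_minus_norm_beta[OF Im_F_alpha_nonneg[OF m]]
    by (simp add: s_def)
  ultimately show ?thesis by simp
qed

text \<open>Analyticity comes from the chain rule for \<open>beta\<close>, the resolvent form of
  \<open>F\<close> and \<open>alpha_vec\<close>; each of the three derivatives is complex
  homogeneous.\<close>

lemma schur_class_if_representation:
  assumes rep: "\<And>z. z \<in> poly_halfplane \<Longrightarrow> F z = of_real C + cinner (R z v\<^sub>1) v\<^sub>1"
  shows "\<phi> \<in> schur_class"
  unfolding schur_class_def analytic_multi_def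
proof (intro CollectI conjI ballI)
  fix l :: "complex ^ 'd" assume l: "l \<in> polydisc"
  show "cmod (\<phi> l) \<le> 1" by (rule norm_\<phi>_le[OF l])
  let ?z = "alpha_vec l"
  have z: "?z \<in> poly_halfplane" by (rule alpha_vec_halfplane[OF l])
  obtain \<delta> where \<delta>: "\<delta> > 0" "\<And>r. \<delta> \<le> Im (?z $ r)" using point_halfplane_bound[OF z] by blast
  define dF where "dF h = cinner (R ?z (pt h (R ?z v\<^sub>1))) v\<^sub>1" for h
  have "((\<lambda>z. of_real C + cinner (R z v\<^sub>1) v\<^sub>1) has_derivative dF) (at ?z)"
    using has_derivative_add[OF has_derivative_const cinner_resolvent_has_derivative[OF z]]
    by (simp add: dF_def[abs_def])
  then have dF: "(F has_derivative dF) (at ?z)"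
  \<comment> \<open>The resolvent form is known only on the poly-half-plane, which contains the ball
    of radius \<delta> about \<open>?z\<close>.\<close>
  proof (rule has_derivative_transform_within[OF _ \<delta>(1)])
    fix z assume "dist z ?z < \<delta>"
    then have "0 < Im (z $ r)" for r
      using abs_Im_le_cmod[of "z $ r - ?z $ r"] Finite_Cartesian_Product.norm_nth_le[of "z - ?z" r] \<delta>(2)[of r]
      by (simp add: dist_norm)
    then show "of_real C + cinner (R z v\<^sub>1) v\<^sub>1 = F z" by (simp add: rep poly_halfplane_def)
  qed simp
  define dA where "dA h = (\<chi> r. 2 * \<i> / (1 - l $ r)\<^sup>2 * h $ r)" for h :: "complex ^ 'd"
  have dA: "(alpha_vec has_derivative dA) (at l)"
    using alpha_vec_has_derivative[OF l] by (simp add: dA_def[abs_def])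
  have "(\<phi> has_derivative (\<lambda>h. 2 * \<i> / (F ?z + \<i>)\<^sup>2 * dF (dA h))) (at l)"
    unfolding o_def
    by (intro has_derivative_compose[OF has_derivative_compose[OF dA dF]] beta_has_derivative Im_F_nonneg z)
  moreover have "dF (dA (a *s h)) = a * dF (dA h)" for a h
  proof -
    have "dA (a *s h) = a *s dA h" by (simp add: dA_def vec_eq_iff)
    then show ?thesis
      by (simp add: dF_def point_op_scale_left resolvent_scaleC[OF z] cinner_scaleC_left)
  qed
  ultimately show "\<exists>f'. (\<phi> has_derivative f') (at l) \<and> (\<forall>a h. f' (a *s h) = a * f' h)"
    by (intro exI[of _ "\<lambda>h. 2 * \<i> / (F ?z + \<i>)\<^sup>2 * dF (dA h)"]) simp
qed

text \<open>Along the diagonal the defect of \<phi> is at most \<open>4 * Im (F (iy y))\<close>,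
  which decays like \<open>1 / y\<close>; the distance of the disc points to the boundary is
  \<open>2 / (y + 1)\<close>, of the same order.\<close>

lemma B_point_if_representation:
  assumes rep: "\<And>z. z \<in> poly_halfplane \<Longrightarrow> F z = of_real C + cinner (R z v\<^sub>1) v\<^sub>1"
  shows "B_point \<phi> (vec 1)"
  unfolding B_point_def
proof (intro conjI exI allI)
  \<comment> \<open>Starting at 1 keeps the disc coordinate \<open>(y n - 1) / (y n + 1)\<close>
    nonnegative; it equals \<open>1 - 2 / (n + 2)\<close>.\<close>
  define y where "y n = real (Suc n)" for n
  define l :: "nat \<Rightarrow> complex ^ 'd" where "l n = vec (of_real ((y n - 1) / (y n + 1)))" for n
  have y: "1 \<le> y n" for n by (simp add: y_def)
  have al: "alpha_vec (l n) = iy (y n)" for n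
    unfolding l_def using y[of n] by (intro alpha_vec_diagonal) simp
  have abs: "\<bar>(y n - 1) / (y n + 1)\<bar> = (y n - 1) / (y n + 1)" for n using y[of n] by simp
  show pd: "l n \<in> polydisc" for n
    using y[of n] abs[of n] by (simp add: l_def polydisc_def del: of_real_divide)
  have mx: "1 - max_norm (l n) = 2 / (y n + 1)" for n
    using y[of n] by (simp only: l_def max_norm_vec norm_of_real abs) (simp add: field_simps)
  show "vec 1 \<in> torus" by (simp add: torus_def)
  show "\<phi> \<in> schur_class" by (rule schur_class_if_representation[OF rep])
  have "(\<lambda>n. complex_of_real (1 - 2 * (1 / real (Suc (Suc n))))) \<longlonglongrightarrow> of_real (1 - 2 * 0)"
    by (intro tendsto_intros LIMSEQ_Suc[OF LIMSEQ_Suc[OF lim_1_over_n]])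
  moreover have "1 - 2 * (1 / real (Suc (Suc n))) = (y n - 1) / (y n + 1)" for n
    by (simp add: y_def field_simps)
  ultimately have "(\<lambda>n. complex_of_real ((y n - 1) / (y n + 1))) \<longlonglongrightarrow> 1"
    by (simp only: mult_zero_right diff_zero of_real_1)
  then show "l \<longlonglongrightarrow> vec 1"
    unfolding l_def[abs_def] by (intro vec_tendstoI) (simp only: vec_component)
  have "\<bar>(1 - cmod (\<phi> (l n))) / (1 - max_norm (l n))\<bar> \<le> 4 * (norm v\<^sub>1)\<^sup>2" for n
  proof -
    have "iy (y n) \<in> poly_halfplane" using y[of n] by (intro vec_imaginary_halfplane) simp
    note Im0 = Im_F_nonneg[OF this]
    have le1: "cmod (\<phi> (l n)) \<le> 1" by (rule norm_\<phi>_le[OF pd])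
    have "1 \<le> (cmod (F (iy (y n)) + \<i>))\<^sup>2"
      using abs_Im_le_cmod[of "F (iy (y n)) + \<i>"] Im0 by (intro one_le_power) simp
    then have "1 - (cmod (\<phi> (l n)))\<^sup>2 \<le> 4 * Im (F (iy (y n))) / 1"
      using Im0 unfolding o_apply al one_minus_norm_beta[OF Im0] by (intro divide_left_mono) auto
    also have "Im (F (iy (y n))) \<le> cmod (F (iy (y n)) - of_real C)"
      using abs_Im_le_cmod[of "F (iy (y n)) - of_real C"] by simp
    also have "\<dots> \<le> (norm v\<^sub>1)\<^sup>2 / y n"
      using y[of n] by (intro F_decay_if_representation[OF rep]) auto
    finally have "1 - cmod (\<phi> (l n)) \<le> 4 * ((norm v\<^sub>1)\<^sup>2 / y n)"
      using one_minus_square_bounds(1)[OF norm_ge_zero le1] by simp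
    then have "(1 - cmod (\<phi> (l n))) / (2 / (y n + 1)) \<le> 4 * ((norm v\<^sub>1)\<^sup>2 / y n) / (2 / (y n + 1))"
      using y[of n] by (intro divide_right_mono) auto
    also have "\<dots> = (norm v\<^sub>1)\<^sup>2 * (2 * (y n + 1) / y n)" by simp
    also have "\<dots> \<le> (norm v\<^sub>1)\<^sup>2 * 4"
      using y[of n] by (intro mult_left_mono) (auto simp: field_simps)
    finally show ?thesis using le1 y[of n] by (simp add: mx)
  qed
  then show "bounded (range (\<lambda>n. (1 - cmod (\<phi> (l n))) / (1 - max_norm (l n))))"
    unfolding bounded_iff by (intro exI[of _ "4 * (norm v\<^sub>1)\<^sup>2"]) auto
qed

lemma nt_value_if_representation:
  assumes rep: "\<And>z. z \<in> poly_halfplane \<Longrightarrow> F z = of_real C + cinner (R z v\<^sub>1) v\<^sub>1"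
  shows "nt_value \<phi> (vec 1) = beta (of_real C)"
  unfolding nt_value_def
proof (rule tendsto_Lim[OF nontangential_nontrivial], rule tendsto_nontangentialI)
  fix a and l :: "complex ^ 'd" assume l: "l \<in> approach_region (vec 1) a"
  define r where "r = max_norm (l - vec 1)"
  note b = approach_region_bound[OF l r_def]
  \<comment> \<open>Within the approach region the Cayley images are high up in every coordinate, so
    the resolvent bound makes \<open>F - C\<close> of order \<open>a * r\<close>.\<close>
  have "1 / (2 * a * r) \<le> Im (alpha_vec l $ k)" for k
  proof -
    have lt: "cmod (l $ k) < 1" using b(1) by (simp add: polydisc_def)
    then have "0 < (cmod (1 - l $ k))\<^sup>2" by auto
    then show ?thesis using b(2,3) b(4)[of k] lt by (simp add: alpha_vec_def Im_alpha field_simps)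
  qed
  then have "cmod (F (alpha_vec l) - of_real C) \<le> (norm v\<^sub>1)\<^sup>2 / (1 / (2 * a * r))"
    using b(2,3) by (intro F_decay_if_representation[OF rep]) auto
  then have "2 * cmod (F (alpha_vec l) - of_real C) \<le> 4 * (norm v\<^sub>1)\<^sup>2 * (a * r)"
    by (simp add: mult_ac)
  moreover have "cmod (\<phi> l - beta (of_real C)) \<le> 2 * cmod (F (alpha_vec l) - of_real C)"
    using norm_beta_diff_le[of "F (alpha_vec l)" "of_real C"] Im_F_alpha_nonneg[OF b(1)] by simp
  ultimately show "cmod (\<phi> l - beta (of_real C)) \<le> 4 * (norm v\<^sub>1)\<^sup>2 * (a * max_norm (l - vec 1))"
    unfolding r_def by (rule order_trans[rotated])
qed

text \<open>Julia's inequality gives convergence of \<phi> to \<omega> at a linear rate, so \<omega>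
  is the nontangential value. As it is not 1, the inverse Cayley transform is Lipschitz near it and
  keeps the rate.\<close>

lemma F_decay_if_B_point:
  assumes B: "B_point \<phi> (vec 1)" and ne: "nt_value \<phi> (vec 1) \<noteq> 1"
  obtains C K :: real where "\<forall>\<^sub>F y in at_top. y * cmod (F (iy y) - of_real C) \<le> K"
proof -
  obtain \<omega> K where \<omega>: "cmod \<omega> = 1" "0 \<le> K" and
    julia: "\<And>l Q. l \<in> polydisc \<Longrightarrow> (\<And>r. (cmod (1 - l $ r))\<^sup>2 < Q * (1 - (cmod (l $ r))\<^sup>2)) \<Longrightarrow>
      cmod (\<phi> l - \<omega>) \<le> K * Q"
  proof (rule julia[of \<phi>])
    fix \<omega> K assume "cmod \<omega> = 1" "0 \<le> K" "\<And>l Q. l \<in> polydisc \<Longrightarrow>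
      (\<And>r. (cmod (1 - l $ r))\<^sup>2 < Q * (1 - (cmod (l $ r))\<^sup>2)) \<Longrightarrow> cmod (\<phi> l - \<omega>) \<le> K * Q"
    then show thesis by (rule that)
  qed (rule norm_\<phi>_le schwarz_pick_polydisc B; assumption)+
  have near: "cmod (\<phi> l - \<omega>) \<le> 2 * K * (a * max_norm (l - vec 1))"
    if l: "l \<in> approach_region (vec 1) a" for a l
  proof -
    note b = approach_region_bound[OF l refl]
    show ?thesis using julia[OF b(1), of "2 * a * max_norm (l - vec 1)"] b(4) by (simp add: mult_ac)
  qed
  have "nt_value \<phi> (vec 1) = \<omega>"
    unfolding nt_value_def
    by (rule tendsto_Lim[OF nontangential_nontrivial tendsto_nontangentialI[OF near]])
  then have \<omega>1: "\<omega> \<noteq> 1" using ne by simp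
  \<comment> \<open>\<open>C\<close> is the Cayley image of \<omega>, real because \<omega> is
    unimodular.\<close>
  define C where "C = Re (\<i> * (1 + \<omega>) / (1 - \<omega>))"
  define e where "e = cmod (1 - \<omega>)"
  have e: "0 < e" using \<omega>1 by (simp add: e_def)
  have C: "of_real C = \<i> * (1 + \<omega>) / (1 - \<omega>)"
  proof -
    have *: "\<omega> * cnj \<omega> = 1" using complex_norm_square[of \<omega>] \<omega>(1) by simp
    have nz: "1 - \<omega> \<noteq> 0" "1 - cnj \<omega> \<noteq> 0" using \<omega>1 by (auto dest: arg_cong[of _ 1 cnj])
    have "cnj (\<i> * (1 + \<omega>) / (1 - \<omega>)) = \<i> * (1 + \<omega>) / (1 - \<omega>)"
      using nz * by (simp add: field_simps)
    then show ?thesis unfolding C_def by (metis Reals_cnj_iff of_real_Re)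
  qed
  have "\<forall>\<^sub>F y in at_top. y * cmod (F (iy y) - of_real C) \<le> 16 * K / e\<^sup>2"
    \<comment> \<open>From \<open>8 * K / e\<close> on, \<open>W\<close> is within
      \<open>e / 2\<close> of \<omega>, hence at distance at least \<open>e / 2\<close> from 1. The
      constant in the claim arises as \<open>2 * (4 * K) / (e / 2 * e)\<close>.\<close>
    using eventually_ge_at_top[of "max 1 (8 * K / e)"]
  proof eventually_elim
    case (elim y)
    define s where "s = (y - 1) / (y + 1)"
    define W where "W = \<phi> (vec (of_real s))"
    have y: "1 \<le> y" "8 * K / e \<le> y" using elim by simp_all
    have s: "0 \<le> s" "s < 1" "1 - s = 2 / (y + 1)" using y by (simp_all add: s_def field_simps)
    have "(vec (complex_of_real s) - vec 1 :: complex ^ 'd) = vec (of_real (s - 1))"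
      by (simp add: vec_eq_iff)
    then have "cmod (W - \<omega>) \<le> 2 * K * (1 - s)"
      using near[OF vec_in_approach_region[OF s(1,2)]] s
      by (simp add: W_def max_norm_vec del: of_real_diff)
    also have "\<dots> = 4 * K / (y + 1)" by (simp add: s)
    also have "\<dots> \<le> 4 * K / y" using y \<omega>(2) by (intro divide_left_mono) auto
    finally have W: "cmod (W - \<omega>) \<le> 4 * K / y" .
    moreover have "4 * K / y \<le> e / 2" using y e by (simp add: field_simps)
    ultimately have "e / 2 \<le> cmod (1 - W)"
      using norm_triangle_ineq[of "1 - W" "W - \<omega>"] by (simp add: e_def)
    note W2 = this
    have Weq: "W = beta (F (iy y))" using y by (simp only: W_def s_def o_apply alpha_vec_diagonal)
    have nz: "F (iy y) + \<i> \<noteq> 0"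
      using y by (intro plus_i_nonzero Im_F_nonneg vec_imaginary_halfplane) simp
    have W1: "1 - W \<noteq> 0" using W2 e by auto
    have "1 + W = 2 * F (iy y) / (F (iy y) + \<i>)" "1 - W = 2 * \<i> / (F (iy y) + \<i>)"
      using nz by (simp_all add: Weq beta_def field_simps)
    then have Feq: "F (iy y) = \<i> * (1 + W) / (1 - W)" using nz by simp
    have num: "\<i> * (1 + W) * (1 - \<omega>) - \<i> * (1 + \<omega>) * (1 - W) = 2 * \<i> * (W - \<omega>)"
      by (simp add: algebra_simps)
    have \<omega>2: "1 - \<omega> \<noteq> 0" using \<omega>1 by simp
    have "F (iy y) - of_real C = 2 * \<i> * (W - \<omega>) / ((1 - W) * (1 - \<omega>))"
      unfolding C Feq diff_frac_eq[OF W1 \<omega>2] num ..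
    then have "cmod (F (iy y) - of_real C) = 2 * cmod (W - \<omega>) / (cmod (1 - W) * e)"
      by (simp add: norm_mult norm_divide e_def)
    also have "\<dots> \<le> 2 * (4 * K / y) / (e / 2 * e)"
      using W W2 e y \<omega>(2) by (intro frac_le mult_left_mono mult_right_mono mult_pos_pos) auto
    finally have "cmod (F (iy y) - of_real C) \<le> 16 * K / e\<^sup>2 / y"
      by (simp add: power2_eq_square mult_ac)
    then have "y * cmod (F (iy y) - of_real C) \<le> y * (16 * K / e\<^sup>2 / y)"
      using y by (intro mult_left_mono) auto
    then show ?case using y by simp
  qed
  then show thesis by (rule that)
qed

end

section \<open>Equivalence of the five conditions\<close>

theorem theorem6p33:
  fixes F :: "complex ^ 'd \<Rightarrow> complex"
    and c :: real
    and z\<^sub>0 :: "complex ^ 'd"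
    and M :: "'d \<Rightarrow> 'h::complex_hilbert set"
    and D :: "'h set"
    and X :: "'h \<Rightarrow> 'h"
    and v :: 'h
    and v_at :: "complex ^ 'd \<Rightarrow> 'h"
  assumes "F \<in> loewner_class"
    and "z\<^sub>0 \<in> poly_halfplane"
    and "orthogonal_decomposition M"
    and "self_adjoint D X"
    and "\<And>z. z \<in> poly_halfplane \<Longrightarrow>
           F z = complex_of_real c + cinner (point_op M z v) v
             + cinner (point_op M (z - cnj_vec z\<^sub>0)
                 (resolvent M D X z (point_op M (z - z\<^sub>0) v))) v"
    and "\<And>z. z \<in> poly_halfplane \<Longrightarrow>
           v_at z = v + resolvent M D X z (point_op M (z - z\<^sub>0) v)"
  defines "cond_i \<equiv> \<exists>C::real.
      Liminf at_top (\<lambda>y::real. ereal (y * cmod (F (vec (\<i> * of_real y)) - of_real C))) < \<infinity>"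
    and "cond_ii \<equiv> \<exists>(v\<^sub>1::'h) (C::real). \<forall>z\<in>poly_halfplane.
      F z = of_real C + cinner (resolvent M D X z v\<^sub>1) v\<^sub>1"
    and "cond_iii \<equiv>
      beta \<circ> F \<circ> alpha_vec \<in> schur_class \<and>
      B_point (beta \<circ> F \<circ> alpha_vec) (vec 1) \<and>
      nt_value (beta \<circ> F \<circ> alpha_vec) (vec 1) \<noteq> 1"
    and "cond_iv \<equiv>
      (\<exists>C::real. ((\<lambda>y::real. F (vec (\<i> * of_real y))) \<longlongrightarrow> of_real C) at_top) \<and>
      Liminf at_top (\<lambda>y::real. ereal (y * norm (v_at (vec (\<i> * of_real y))))) < \<infinity>"
    and "cond_v \<equiv> v \<in> D"
  shows "(cond_i \<longleftrightarrow> cond_ii) \<and> (cond_ii \<longleftrightarrow> cond_iii) \<and>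
         (cond_iii \<longleftrightarrow> cond_iv) \<and> (cond_iv \<longleftrightarrow> cond_v)"
proof -
  interpret loewner_representation M D X F c z\<^sub>0 v v_at
    using assms(3-6) by unfold_locales
  \<comment> \<open>The scheme of implications: (i) and (iv) each give (v), (v) gives (ii), (iii)
    gives (i), and (ii) gives (i), (iii) and (iv).\<close>
  have i_v: cond_v if cond_i
    using that v_at_decay_if_F_decay dom_if_v_at_decay
    unfolding cond_i_def cond_v_def Liminf_ereal_less_infinity_iff by blast
  have iv_v: cond_v if cond_iv
    using that dom_if_v_at_decay
    unfolding cond_iv_def cond_v_def Liminf_ereal_less_infinity_iff by blast
  have v_ii: cond_ii if cond_v
    using that representation_if_dom unfolding cond_v_def cond_ii_def by metis
  have iii_i: cond_i if cond_iii
  proof -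
    obtain C K where "\<forall>\<^sub>F y in at_top. y * cmod (F (iy y) - of_real C) \<le> K"
      using F_decay_if_B_point \<open>cond_iii\<close> unfolding cond_iii_def by blast
    then show ?thesis
      unfolding cond_i_def Liminf_ereal_less_infinity_iff
      by (meson eventually_frequently trivial_limit_at_top_linorder)
  qed
  have ii_rest: "cond_i \<and> cond_iii \<and> cond_iv" if cond_ii
  proof -
    obtain v\<^sub>1 C where rep: "\<And>z. z \<in> poly_halfplane \<Longrightarrow> F z = of_real C + cinner (R z v\<^sub>1) v\<^sub>1"
      using \<open>cond_ii\<close> unfolding cond_ii_def by blast
    have bound: "\<forall>\<^sub>F y in at_top. cmod (F (iy y) - of_real C) \<le> (norm v\<^sub>1)\<^sup>2 / y"
      using eventually_gt_at_top[of 0]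
      by eventually_elim (rule F_decay_if_representation[OF rep], simp_all)
    then have "\<forall>\<^sub>F y in at_top. y * cmod (F (iy y) - of_real C) \<le> (norm v\<^sub>1)\<^sup>2"
      using eventually_gt_at_top[of 0] by eventually_elim (simp add: field_simps)
    then have freq: "\<exists>\<^sub>F y in at_top. y * cmod (F (iy y) - of_real C) \<le> (norm v\<^sub>1)\<^sup>2"
      by (rule eventually_frequently[OF trivial_limit_at_top_linorder])
    have lim: "((\<lambda>y. F (iy y)) \<longlongrightarrow> of_real C) at_top"
    proof (rule LIM_zero_cancel, rule Lim_null_comparison[OF bound])
      show "((\<lambda>y. (norm v\<^sub>1)\<^sup>2 / y) \<longlongrightarrow> 0) at_top"
        by (rule real_tendsto_divide_at_top[OF tendsto_const filterlim_ident])
    qed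
    have nt: "nt_value \<phi> (vec 1) = beta (of_real C)"
      by (rule nt_value_if_representation) (rule rep)
    have nt_ne: "nt_value \<phi> (vec 1) \<noteq> 1"
      unfolding nt by (rule beta_of_real_neq_1)
    show ?thesis
      using lim nt_ne freq v_at_decay_if_F_decay[OF freq] schur_class_if_representation[OF rep] B_point_if_representation[OF rep]
      unfolding cond_i_def cond_iii_def cond_iv_def Liminf_ereal_less_infinity_iff by blast
  qed
  show ?thesis using i_v iv_v v_ii iii_i ii_rest by blast
qed

end
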